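(* A single-vertex crease pattern $C$ is rigidly foldable if and only if $C$ has at least four creases, all sector angles of $C$ are strictly less than $\pi$, and $C$ is not an unspecified cross.
   Context: The paper is a closed disk $A\subset\mathbb{R}^2$. A single-vertex crease pattern $C$ is a finite set of more than two distinct creases, which are radii of $A$ issuing from the center of $A$ (the vertex). The creases divide $A$ into sectors (faces). The sector angles of $C$ are the angles at the vertex of these sectors, i.e. the angles between cyclically consecutive creases. The folding angle of a crease under a map that is isometric on each face is the signed angle by which the two adjacent faces deviate from being coplanar. $C$ is rigidly foldable if there exists an injective continuous map $f:A\to\mathbb{R}^3$ that is an isometry on each face (each face is mapped rigidly onto a congruent planar sector) and is a rigid origami with crease pattern $C$, meaning that $f$ is non-differentiable exactly along the creases, i.e. every crease in $C$ has non-zero folding angle. No mountain-valley assignment is prescribed. $C$ is an unspecified cross if it consists of exactly four creases $c_1,c_2,c_3,c_4$ (in counterclockwise order) such that $c_1$ and $c_3$ form a straight line and $c_2$ and $c_4$ form a straight line. *)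

theory Defs
  imports "HOL-Analysis.Analysis"
begin

text \<open>
  The plane of the paper is the Euclidean plane \<^typ>\<open>complex\<close>, whose norm is the Euclidean one and
  whose differentiability (\<^const>\<open>differentiable\<close>) is real differentiability.  The paper is the disk
  \<^term>\<open>cball v r\<close> with vertex \<open>v\<close>.  A radius of the disk is determined by its end point on the
  boundary circle, so a crease pattern is given by the set \<open>C\<close> of end points of its creases.
\<close>

definition crease :: "complex \<Rightarrow> complex \<Rightarrow> complex set" where
  "crease v p = closed_segment v p"

definition crease_pattern :: "complex \<Rightarrow> real \<Rightarrow> complex set \<Rightarrow> bool" where
  "crease_pattern v r C \<longleftrightarrow> finite C \<and> card C > 2 \<and> C \<subseteq> sphere v r"

text \<open>
  The counterclockwise angle at \<open>v\<close>, in \<open>[0, 2 * pi)\<close>, from the ray through \<open>p\<close> to the ray through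
  \<open>q\<close>.  By the convention \<open>Arg2pi 0 = 0\<close> it is \<open>0\<close> for \<open>q = v\<close>.
\<close>

definition ccw_angle :: "complex \<Rightarrow> complex \<Rightarrow> complex \<Rightarrow> real" where
  "ccw_angle v p q = Arg2pi ((q - v) / (p - v))"

definition next_crease :: "complex \<Rightarrow> complex set \<Rightarrow> complex \<Rightarrow> complex \<Rightarrow> bool" where
  "next_crease v C p q \<longleftrightarrow> p \<in> C \<and> q \<in> C \<and> q \<noteq> p \<and>
     (\<forall>s\<in>C. s \<noteq> p \<longrightarrow> ccw_angle v p q \<le> ccw_angle v p s)"

definition sector_angles :: "complex \<Rightarrow> complex set \<Rightarrow> real set" where
  "sector_angles v C = {ccw_angle v p q | p q. next_crease v C p q}"

text \<open>
  The closed sector of the disk swept counterclockwise from the crease at \<open>p\<close> to the crease at \<open>q\<close>;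
  it contains both creases, including \<open>v\<close>.
\<close>

definition sector :: "complex \<Rightarrow> real \<Rightarrow> complex \<Rightarrow> complex \<Rightarrow> complex set" where
  "sector v r p q = {x \<in> cball v r. ccw_angle v p x \<le> ccw_angle v p q}"

definition faces :: "complex \<Rightarrow> real \<Rightarrow> complex set \<Rightarrow> complex set set" where
  "faces v r C = {sector v r p q | p q. next_crease v C p q}"

text \<open>
  A map preserving the distances of the ambient spaces on a face maps it rigidly onto a congruent
  planar sector.  Differentiability is taken relative to the disk, so that it is meaningful on the
  boundary circle as well.
\<close>

definition rigid_origami :: "complex \<Rightarrow> real \<Rightarrow> complex set \<Rightarrow> (complex \<Rightarrow> real^3) \<Rightarrow> bool" where
  "rigid_origami v r C f \<longleftrightarrow>
     continuous_on (cball v r) f \<and>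
     inj_on f (cball v r) \<and>
     (\<forall>F\<in>faces v r C. \<forall>x\<in>F. \<forall>y\<in>F. dist (f x) (f y) = dist x y) \<and>
     {x \<in> cball v r. \<not> f differentiable (at x within cball v r)} = (\<Union>p\<in>C. crease v p)"

definition rigidly_foldable :: "complex \<Rightarrow> real \<Rightarrow> complex set \<Rightarrow> bool" where
  "rigidly_foldable v r C \<longleftrightarrow> (\<exists>f. rigid_origami v r C f)"

text \<open>Two distinct radii form a straight line iff their union is collinear.\<close>

definition unspecified_cross :: "complex \<Rightarrow> complex set \<Rightarrow> bool" where
  "unspecified_cross v C \<longleftrightarrow>
     (\<exists>p1 p2 p3 p4. C = {p1, p2, p3, p4} \<and> card C = 4 \<and>
        next_crease v C p1 p2 \<and> next_crease v C p2 p3 \<and>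
        next_crease v C p3 p4 \<and> next_crease v C p4 p1 \<and>
        collinear (crease v p1 \<union> crease v p3) \<and>
        collinear (crease v p2 \<union> crease v p4))"

end

theory Submission
  imports Defs
begin

text \<open>
  Fix the vertex \<open>v\<close>. A rigid folding is linear on each face and, the disk being convex, a contraction.
  Necessity rests on one rigidity fact: no diameter is mapped to a diameter. If \<open>f a\<close> and \<open>f b\<close> are
  antipodal for antipodal \<open>a\<close>, \<open>b\<close>, then contraction towards \<open>f a\<close> and \<open>f b\<close> fixes the component of every
  \<open>f x\<close> along that axis, and \<open>f\<close> is affine around any crease off the diameter. A sector angle of at
  least \<open>pi\<close> contains a diameter; three creases with smaller angles satisfy a positive linear relation,
  which \<open>f\<close> preserves; and for a cross either one of the two lines stays straight or the images of two
  opposite faces meet.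

  For sufficiency, lift the unit vectors along the creases to heights \<open>sqrt x * h i\<close>. The angles of their
  shadows in the plane are forced, and the lift closes up iff these angles add up to \<open>2 * pi\<close>. To
  first order in \<open>x\<close> the excess is a quadratic form in \<open>h\<close>, while the fold at a crease is nontrivial iff a
  linear functional of the heights, the bend, does not vanish. Unless the pattern is a cross, the form
  has a zero at which no bend vanishes; the form changes sign near it, so the intermediate value theorem
  gives exact solutions for all small \<open>x\<close>. The folded map is then close to the flat embedding in the
  Lipschitz sense, hence injective.
\<close>

section \<open>The quadratic excess form of a height vector\<close>

text \<open>The derivative at \<open>x = 0\<close> of the sum of the shadow angles when crease
  \<open>i\<close> gets the height \<open>sqrt x * h i\<close>; see
  \<open>DERIV_shadow_angle\<close>.\<close>

definition excess_form :: "nat \<Rightarrow> (nat \<Rightarrow> real) \<Rightarrow> (nat \<Rightarrow> real) \<Rightarrow> real" where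
  "excess_form n \<theta> h =
     (\<Sum>i<n. (h i * h (Suc i) - cos (\<theta> i) * ((h i)\<^sup>2 + (h (Suc i))\<^sup>2) / 2) / sin (\<theta> i))"

text \<open>The coefficients are those of the linear relation between three consecutive crease
  directions, see \<open>three_directions_relation\<close>. The value at \<open>i\<close> thus
  measures the fold at crease \<open>Suc i\<close>: for angles in the open interval from 0 to pi it
  is zero iff the three heights come from one linear functional on the plane.\<close>

definition bend :: "(nat \<Rightarrow> real) \<Rightarrow> (nat \<Rightarrow> real) \<Rightarrow> nat \<Rightarrow> real" where
  "bend \<theta> h i = sin (\<theta> (Suc i)) * h i - sin (\<theta> i + \<theta> (Suc i)) * h (Suc i)
                + sin (\<theta> i) * h (Suc (Suc i))"

definition periodic :: "nat \<Rightarrow> (nat \<Rightarrow> 'a) \<Rightarrow> bool" where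
  "periodic n h \<longleftrightarrow> (\<forall>i. h (i + n) = h i)"

lemma periodicD: "periodic n h \<Longrightarrow> h (i + n) = h i"
  by (simp add: periodic_def)

lemma periodic_mod:
  assumes "periodic n h"
  shows "h (i mod n) = h i"
proof -
  have "h (j + q * n) = h j" for j q
    by (induction q) (simp_all add: periodicD[OF assms] add.assoc[symmetric] add.commute[of n])
  from this[of "i mod n" "i div n"] show ?thesis by simp
qed

lemma sum_periodic_shift:
  fixes g :: "nat \<Rightarrow> real"
  assumes "periodic n g"
  shows "(\<Sum>i<n. g (i + m)) = (\<Sum>i<n. g i)"
proof (induction m)
  case (Suc m)
  have "(\<Sum>i<n. g (i + Suc m)) + g m = (\<Sum>i<Suc n. g (i + m))"
    by (subst sum.lessThan_Suc_shift) simp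
  also have "\<dots> = (\<Sum>i<n. g (i + m)) + g m"
    using periodicD[OF assms, of m] by (simp add: add.commute)
  finally show ?case using Suc by simp
qed simp

lemma excess_form_shift:
  assumes "periodic n \<theta>" "periodic n h"
  shows "excess_form n (\<lambda>i. \<theta> (i + m)) (\<lambda>i. h (i + m)) = excess_form n \<theta> h"
proof -
  let ?g = "\<lambda>i. (h i * h (Suc i) - cos (\<theta> i) * ((h i)\<^sup>2 + (h (Suc i))\<^sup>2) / 2) / sin (\<theta> i)"
  have "periodic n ?g"
    using assms periodicD[OF assms(2), of "Suc i" for i] by (simp add: periodic_def)
  from sum_periodic_shift[OF this, of m] show ?thesis
    by (simp add: excess_form_def)
qed

text \<open>Twice the symmetric bilinear form belonging to \<open>excess_form\<close>, that is, its
  derivative at \<open>k\<close> in direction \<open>d\<close>.\<close>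

definition excess_polar :: "nat \<Rightarrow> (nat \<Rightarrow> real) \<Rightarrow> (nat \<Rightarrow> real) \<Rightarrow> (nat \<Rightarrow> real) \<Rightarrow> real" where
  "excess_polar n \<theta> k d = (\<Sum>i<n. (k i * d (Suc i) + d i * k (Suc i)
     - cos (\<theta> i) * (k i * d i + k (Suc i) * d (Suc i))) / sin (\<theta> i))"

lemma excess_form_line:
  "excess_form n \<theta> (\<lambda>i. k i + t * d i)
     = excess_form n \<theta> k + excess_polar n \<theta> k d * t + excess_form n \<theta> d * t\<^sup>2"
  unfolding excess_form_def excess_polar_def sum_distrib_right sum.distrib[symmetric]
  by (intro sum.cong refl)
     (simp add: add_divide_distrib diff_divide_distrib power2_eq_square algebra_simps)

lemma bend_line: "bend \<theta> (\<lambda>i. k i + t * d i) j = bend \<theta> k j + t * bend \<theta> d j"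
  by (simp add: bend_def algebra_simps)

definition bump :: "nat \<Rightarrow> nat \<Rightarrow> nat \<Rightarrow> real" where
  "bump n j i = (if i mod n = j mod n then 1 else 0)"

lemma periodic_bump: "periodic n (bump n j)"
  by (simp add: periodic_def bump_def)

lemma bump_shift: "bump n (j + m) (i + m) = bump n j i"
  unfolding bump_def of_nat_eq_iff[where 'a = int, symmetric]
  by (simp add: zmod_int mod_eq_dvd_iff)

text \<open>Only the summands 0, 1, 2 survive. Each height collects half the cotangents of its two
  adjacent angles, and \<open>cot a + cot b = sin (a + b) / (sin a * sin b)\<close> reduces the sign
  of a diagonal coefficient to a comparison of \<open>a + b\<close> with pi.\<close>

lemma excess_form_two_heights:
  assumes "n \<ge> 4" "h 0 = 0" "\<And>i. 3 \<le> i \<Longrightarrow> i \<le> n \<Longrightarrow> h i = 0"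
    and "sin (\<theta> 0) \<noteq> 0" "sin (\<theta> 1) \<noteq> 0" "sin (\<theta> 2) \<noteq> 0"
  shows "excess_form n \<theta> h =
    - (sin (\<theta> 0 + \<theta> 1) / (2 * sin (\<theta> 0) * sin (\<theta> 1))) * (h 1)\<^sup>2
    - (sin (\<theta> 1 + \<theta> 2) / (2 * sin (\<theta> 1) * sin (\<theta> 2))) * (h 2)\<^sup>2
    + h 1 * h 2 / sin (\<theta> 1)"
proof -
  let ?g = "\<lambda>i. (h i * h (Suc i) - cos (\<theta> i) * ((h i)\<^sup>2 + (h (Suc i))\<^sup>2) / 2) / sin (\<theta> i)"
  have "(\<Sum>i<n. ?g i) = (\<Sum>i<3. ?g i) + (\<Sum>i\<in>{3..<n}. ?g i)"
    using sum.atLeastLessThan_concat[of 0 3 n ?g] assms(1) unfolding lessThan_atLeast0 by simp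
  also have "(\<Sum>i\<in>{3..<n}. ?g i) = 0"
    using assms(3) by (intro sum.neutral) auto
  also have "(\<Sum>i<3. ?g i) = ?g 0 + ?g 1 + ?g 2"
    by (simp add: numeral_3_eq_3 numeral_2_eq_2)
  finally have "excess_form n \<theta> h = ?g 0 + ?g 1 + ?g 2"
    by (simp add: excess_form_def)
  also have "?g 0 = - (cos (\<theta> 0) / sin (\<theta> 0)) * (h 1)\<^sup>2 / 2"
    using assms(2) by simp
  also have "?g 1 = h 1 * h 2 / sin (\<theta> 1)
      - (cos (\<theta> 1) / sin (\<theta> 1)) * ((h 1)\<^sup>2 + (h 2)\<^sup>2) / 2"
    by (simp add: numeral_2_eq_2 diff_divide_distrib)
  also have "?g 2 = - (cos (\<theta> 2) / sin (\<theta> 2)) * (h 2)\<^sup>2 / 2"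
    using assms(1) assms(3)[of 3] by (simp add: numeral_3_eq_3 numeral_2_eq_2)
  finally have Q: "excess_form n \<theta> h =
      - (cos (\<theta> 0) / sin (\<theta> 0)) * (h 1)\<^sup>2 / 2
      + (h 1 * h 2 / sin (\<theta> 1) - (cos (\<theta> 1) / sin (\<theta> 1)) * ((h 1)\<^sup>2 + (h 2)\<^sup>2) / 2)
      + - (cos (\<theta> 2) / sin (\<theta> 2)) * (h 2)\<^sup>2 / 2" .
  have cot: "sin (a + b) / (2 * sin a * sin b) = (cos a / sin a + cos b / sin b) / 2"
    if "sin a \<noteq> 0" "sin b \<noteq> 0" for a b :: real
    using that by (simp add: sin_add field_simps)
  show ?thesis
    unfolding Q cot[OF assms(4,5)] cot[OF assms(5,6)] by algebra
qed

lemma eventually_quadratic_nonzero: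
  fixes a b c :: real
  assumes "a \<noteq> 0 \<or> c \<noteq> 0"
  shows "\<forall>\<^sub>F t in at 0. a + b * t + c * t\<^sup>2 \<noteq> 0"
proof -
  have *: "a + b * t + c * t\<^sup>2 = poly [:a, b, c:] t" for t
    by (simp add: power2_eq_square algebra_simps)
  have "finite {t. a + b * t + c * t\<^sup>2 = 0}"
    unfolding * using assms by (intro poly_roots_finite) auto
  \<comment> \<open>\<open>at 0\<close> omits 0 itself, so a root at 0 may be dropped from the
    exceptional set.\<close>
  then have "open (- ({t. a + b * t + c * t\<^sup>2 = 0} - {0}))"
    by (intro open_Compl finite_imp_closed finite_Diff)
  then show ?thesis
    unfolding eventually_at_topological
    by (intro exI[of _ "- ({t. a + b * t + c * t\<^sup>2 = 0} - {0})"]) auto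
qed

section \<open>Null vectors of the excess form without zero bends\<close>

locale angle_cycle =
  fixes n :: nat and \<theta> :: "nat \<Rightarrow> real"
  assumes n4: "n \<ge> 4"
    and per: "periodic n \<theta>"
    and pos: "0 < \<theta> i"
    and lt_pi: "\<theta> i < pi"
    and total: "(\<Sum>i<n. \<theta> i) = 2 * pi"
begin

lemma sin_pos: "sin (\<theta> i) > 0"
  by (simp add: pos lt_pi sin_gt_zero)

text \<open>The addition formula turns the bend into a positive combination of two terms
  \<open>1 - cos\<close>. Hence every bend can be cancelled by exactly one multiple of the constant
  vector.\<close>

lemma bend_one_pos: "bend \<theta> (\<lambda>_. 1) i > 0"
proof -
  have "cos (\<theta> j) < 1" for j
    using cos_monotone_0_pi[of 0 "\<theta> j"] pos[of j] lt_pi[of j] by simp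
  then have "sin (\<theta> (Suc i)) * (1 - cos (\<theta> i)) + sin (\<theta> i) * (1 - cos (\<theta> (Suc i))) > 0"
    by (intro add_pos_pos mult_pos_pos sin_pos) auto
  then show ?thesis by (simp add: bend_def sin_add algebra_simps)
qed

text \<open>Equal heights form a cone, and each summand is \<open>(1 - cos) / sin\<close>. Moving
  far enough along the constant vector therefore makes the form positive.\<close>

lemma excess_form_one_pos: "excess_form n \<theta> (\<lambda>_. 1) > 0"
proof -
  have "cos (\<theta> j) < 1" for j
    using cos_monotone_0_pi[of 0 "\<theta> j"] pos[of j] lt_pi[of j] by simp
  then show ?thesis unfolding excess_form_def using n4 
    by (intro sum_pos) (auto intro!: divide_pos_pos sin_pos simp: lessThan_empty_iff)
qed

lemma shift: "angle_cycle n (\<lambda>i. \<theta> (i + m))"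
proof
  show "periodic n (\<lambda>i. \<theta> (i + m))"
    using periodicD[OF per, of "i + m" for i] by (simp add: periodic_def algebra_simps)
  show "(\<Sum>i<n. \<theta> (i + m)) = 2 * pi"
    using sum_periodic_shift[OF per] total by simp
qed (use n4 pos lt_pi in auto)

text \<open>Cyclic invariance rotates the two raised creases to the positions 1 and 2.\<close>

lemma excess_form_bump_pair:
  assumes "n \<ge> 5 \<or> b = 0"
  shows "excess_form n \<theta> (\<lambda>i. a * bump n (Suc m) i + b * bump n (Suc (Suc m)) i) =
    - (sin (\<theta> m + \<theta> (Suc m)) / (2 * sin (\<theta> m) * sin (\<theta> (Suc m)))) * a\<^sup>2
    - (sin (\<theta> (Suc m) + \<theta> (Suc (Suc m))) / (2 * sin (\<theta> (Suc m)) * sin (\<theta> (Suc (Suc m))))) * b\<^sup>2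
    + a * b / sin (\<theta> (Suc m))"
proof -
  let ?h = "\<lambda>i. a * bump n (Suc m) i + b * bump n (Suc (Suc m)) i"
  have per_h: "periodic n ?h"
    using periodic_bump by (simp add: periodic_def)
  interpret s: angle_cycle n "\<lambda>i. \<theta> (i + m)" by (rule shift)
  have *: "bump n j i = (if i = j then 1 else 0)" if "i \<le> n" "0 < j" "j < n" for i j
    using that by (cases "i = n") (auto simp: bump_def)
  have "excess_form n \<theta> ?h = excess_form n (\<lambda>i. \<theta> (i + m)) (\<lambda>i. ?h (i + m))"
    by (rule excess_form_shift[OF per per_h, symmetric])
  also have "(\<lambda>i. ?h (i + m)) = (\<lambda>i. a * bump n 1 i + b * bump n 2 i)"
    using bump_shift[of n 1 m] bump_shift[of n 2 m] by (simp add: numeral_2_eq_2)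
  also have "excess_form n (\<lambda>i. \<theta> (i + m)) \<dots> =
    - (sin (\<theta> (0 + m) + \<theta> (1 + m)) / (2 * sin (\<theta> (0 + m)) * sin (\<theta> (1 + m)))) * a\<^sup>2
    - (sin (\<theta> (1 + m) + \<theta> (2 + m)) / (2 * sin (\<theta> (1 + m)) * sin (\<theta> (2 + m)))) * b\<^sup>2
    + a * b / sin (\<theta> (1 + m))"
    using n4 assms s.sin_pos[of 0] s.sin_pos[of 1] s.sin_pos[of 2]
    by (subst excess_form_two_heights) (auto simp: *)
  finally show ?thesis by simp
qed


lemma total4:
  assumes "n = 4"
  shows "\<theta> 0 + \<theta> 1 + \<theta> 2 + \<theta> 3 = 2 * pi"
  using total unfolding assms by (simp add: numeral_eq_Suc)

text \<open>Summing over all cyclically adjacent pairs counts every angle twice and gives 4 pi. If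
  no pair is below pi, then \<open>n \<le> 4\<close>; for \<open>n = 4\<close> complementary pairs
  add up to 2 pi, so every pair equals pi, which is the excluded cross.\<close>

lemma exists_short_pair:
  assumes "\<not> (n = 4 \<and> \<theta> 0 + \<theta> 1 = pi \<and> \<theta> 1 + \<theta> 2 = pi)"
  shows "\<exists>m. \<theta> m + \<theta> (Suc m) < pi"
proof (rule ccontr)
  assume "\<not> ?thesis"
  then have ge: "\<theta> m + \<theta> (Suc m) \<ge> pi" for m by (simp add: not_less)
  show False
  proof (cases "n = 4")
    case True
    then have "\<theta> 4 = \<theta> 0" using periodicD[OF per, of 0] by simp
    with total4[OF True] ge[of 0] ge[of 1] ge[of 2] ge[of 3] have "\<theta> 0 + \<theta> 1 = pi" "\<theta> 1 + \<theta> 2 = pi"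
      by (simp_all add: numeral_eq_Suc)
    with assms True show False by simp
  next
    case False
    with n4 have n5: "real n \<ge> 5" by simp
    have "real n * pi \<le> (\<Sum>i<n. \<theta> i + \<theta> (Suc i))"
      using sum_mono[of "{..<n}" "\<lambda>_. pi" "\<lambda>i. \<theta> i + \<theta> (Suc i)"] ge by simp
    also have "\<dots> = 4 * pi"
      using sum_periodic_shift[OF per, of 1] total by (simp add: sum.distrib)
    finally have "n \<le> 4" by simp
    with n5 show False by simp
  qed
qed

text \<open>Raising only the crease between two sectors of total angle below pi leaves a single
  diagonal term, with negative coefficient.\<close>

lemma exists_negative:
  assumes "\<not> (n = 4 \<and> \<theta> 0 + \<theta> 1 = pi \<and> \<theta> 1 + \<theta> 2 = pi)"
  shows "\<exists>k. periodic n k \<and> excess_form n \<theta> k < 0"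
proof -
  from exists_short_pair[OF assms] obtain m where m: "\<theta> m + \<theta> (Suc m) < pi" ..
  have "sin (\<theta> m + \<theta> (Suc m)) > 0"
    using m pos[of m] pos[of "Suc m"] by (intro sin_gt_zero) auto
  then have "excess_form n \<theta> (bump n (Suc m)) < 0"
    using excess_form_bump_pair[of 0 1 m] sin_pos[of m] sin_pos[of "Suc m"] by simp
  with periodic_bump show ?thesis by blast
qed

lemma periodic_bend: "periodic n h \<Longrightarrow> periodic n (bend \<theta> h)"
  using periodicD[OF per, of "Suc i" for i] periodicD[OF per] periodicD[of n h "Suc i" for i]
    periodicD[of n h "Suc (Suc i)" for i]
  by (simp add: periodic_def bend_def)

text \<open>
  A generic \<open>k\<close> with negative excess is moved along the constant vector until the form vanishes; the
  bend at \<open>i\<close> could vanish there only if the form vanished on the projection of \<open>k\<close> along the constant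
  vector to the hyperplane of zero bend at \<open>i\<close>.
\<close>

lemma exists_null_generic:
  assumes neg: "periodic n k\<^sub>0" "excess_form n \<theta> k\<^sub>0 < 0"
    and gen: "\<And>i. \<exists>d. periodic n d \<and> bend \<theta> d i = 0 \<and> excess_form n \<theta> d \<noteq> 0"
  shows "\<exists>h. periodic n h \<and> excess_form n \<theta> h = 0 \<and> (\<forall>i. bend \<theta> h i \<noteq> 0)"
proof -
  define red where "red i k = (\<lambda>j. k j + (- (bend \<theta> k i / bend \<theta> (\<lambda>_. 1) i)) * 1)" for i k and j :: nat
  have red_line: "red i (\<lambda>j. k j + t * d j) = (\<lambda>j. red i k j + t * red i d j)" for i k t d
    by (simp add: red_def bend_line algebra_simps add_divide_distrib)
  \<comment> \<open>The conditions are arranged one index at a time: a small move along a direction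
    \<open>d\<close> suited to the new index preserves the earlier ones, since each of them is a
    polynomial in \<open>t\<close> that is not identically zero.\<close>
  have "\<exists>k. periodic n k \<and> excess_form n \<theta> k < 0 \<and> (\<forall>i<m. excess_form n \<theta> (red i k) \<noteq> 0)" for m
  proof (induction m)
    case 0
    then show ?case using neg by blast
  next
    case (Suc m)
    then obtain k where k: "periodic n k" "excess_form n \<theta> k < 0"
      "\<And>i. i < m \<Longrightarrow> excess_form n \<theta> (red i k) \<noteq> 0" by blast
    obtain d where d: "periodic n d" "bend \<theta> d m = 0" "excess_form n \<theta> d \<noteq> 0"
      using gen by blast
    have "\<forall>\<^sub>F t in at 0. excess_form n \<theta> (red i (\<lambda>j. k j + t * d j)) \<noteq> 0" if "i < Suc m" for i
    proof -
      \<comment> \<open>For old indices the constant coefficient is nonzero. For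
        \<open>i = m\<close> the zero bend of \<open>d\<close> gives \<open>red m d = d\<close>, so
        the quadratic coefficient is nonzero.\<close>
      have "excess_form n \<theta> (red i k) \<noteq> 0 \<or> excess_form n \<theta> (red i d) \<noteq> 0"
        using that k(3) d(2,3) by (cases "i = m") (auto simp: red_def)
      then show ?thesis
        unfolding red_line excess_form_line using eventually_quadratic_nonzero by simp
    qed
    then have "\<forall>\<^sub>F t in at 0. \<forall>i\<in>{..<Suc m}. excess_form n \<theta> (red i (\<lambda>j. k j + t * d j)) \<noteq> 0"
      by (intro eventually_ball_finite) auto
    moreover have "\<forall>\<^sub>F t in at 0. excess_form n \<theta> (\<lambda>j. k j + t * d j) < 0"
    proof -
      have "((\<lambda>t. excess_form n \<theta> k + excess_polar n \<theta> k d * t + excess_form n \<theta> d * t\<^sup>2) \<longlongrightarrow>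
          excess_form n \<theta> k + excess_polar n \<theta> k d * 0 + excess_form n \<theta> d * 0\<^sup>2) (at 0)"
        by (intro tendsto_intros)
      then show ?thesis unfolding excess_form_line using k(2) by (intro order_tendstoD(2)[where a = 0]) auto
    qed
    ultimately have "\<forall>\<^sub>F t in at 0. excess_form n \<theta> (\<lambda>j. k j + t * d j) < 0 \<and>
        (\<forall>i\<in>{..<Suc m}. excess_form n \<theta> (red i (\<lambda>j. k j + t * d j)) \<noteq> 0)"
      by eventually_elim blast
    then obtain t :: real where "excess_form n \<theta> (\<lambda>j. k j + t * d j) < 0 \<and>
        (\<forall>i\<in>{..<Suc m}. excess_form n \<theta> (red i (\<lambda>j. k j + t * d j)) \<noteq> 0)"
      using eventually_happens[of _ "at (0::real)"] by auto
    moreover have "periodic n (\<lambda>j. k j + t * d j)"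
      using k(1) d(1) by (simp add: periodic_def)
    ultimately show ?case by blast
  qed
  then obtain k where k: "periodic n k" "excess_form n \<theta> k < 0"
      "\<And>i. i < n \<Longrightarrow> excess_form n \<theta> (red i k) \<noteq> 0" by blast
  \<comment> \<open>The form along the constant direction, as a polynomial in the step: negative at
    0 and with positive leading coefficient, hence with a root.\<close>
  let ?p = "[:excess_form n \<theta> k, excess_polar n \<theta> k (\<lambda>_. 1), excess_form n \<theta> (\<lambda>_. 1):]"
  have "\<exists>t. poly ?p t = 0"
  proof -
    have lc: "lead_coeff ?p > 0" using excess_form_one_pos by simp
    then have "\<exists>M. \<forall>x\<ge>M. poly ?p x \<ge> lead_coeff ?p"
      by (intro poly_pinfty_gt_lc) simp
    then obtain M where "\<forall>x\<ge>M. poly ?p x \<ge> lead_coeff ?p" ..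
    with lc have M: "poly ?p x > 0" if "x \<ge> M" for x
      using that order_less_le_trans by blast
    have "poly ?p 0 < 0" using k(2) by simp
    moreover have "poly ?p (max 1 M) > 0" by (rule M) simp
    ultimately show ?thesis
      using poly_IVT_pos[of 0 "max 1 M" ?p] by (meson less_max_iff_disj zero_less_one)
  qed
  then obtain t where t: "excess_form n \<theta> (\<lambda>j. k j + t * 1) = 0"
    unfolding excess_form_line by (auto simp: power2_eq_square algebra_simps)
  have per_h: "periodic n (\<lambda>j. k j + t * 1)"
    using k(1) by (simp add: periodic_def)
  have "bend \<theta> (\<lambda>j. k j + t * 1) i \<noteq> 0" if "i < n" for i
  proof
    assume "bend \<theta> (\<lambda>j. k j + t * 1) i = 0"
    then have "bend \<theta> k i + t * bend \<theta> (\<lambda>_. 1) i = 0" unfolding bend_line .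
    then have "t = - (bend \<theta> k i / bend \<theta> (\<lambda>_. 1) i)"
      using bend_one_pos[of i] by (simp add: field_simps)
    then show False using k(3)[OF that] t by (simp add: red_def)
  qed
  moreover have "i mod n < n" for i using n4 by simp
  ultimately have "bend \<theta> (\<lambda>j. k j + t * 1) i \<noteq> 0" for i
    using periodic_mod[OF periodic_bend[OF per_h], of i] by metis
  with t per_h show ?thesis by blast
qed

lemma sin_pair_nonzero: "\<theta> i + \<theta> (Suc i) \<noteq> pi \<Longrightarrow> sin (\<theta> i + \<theta> (Suc i)) \<noteq> 0"
  using pos[of i] pos[of "Suc i"] lt_pi[of i] lt_pi[of "Suc i"]
    sin_gt_zero[of "\<theta> i + \<theta> (Suc i)"] sin_lt_zero[of "\<theta> i + \<theta> (Suc i)"]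
  by (cases "\<theta> i + \<theta> (Suc i) < pi") auto

text \<open>With heights 0, 0, 1, \<open>c\<close> the coefficient of \<open>c\<^sup>2\<close>
  vanishes because \<open>\<theta> 2 + \<theta> 3 = pi\<close>. The form is then affine in
  \<open>c\<close> and determines \<open>c\<close>, which is nonzero because the other two creases
  are not opposite.\<close>

lemma exists_null_one_line:
  assumes n: "n = 4" and line: "\<theta> 0 + \<theta> 1 = pi" and other: "\<theta> 1 + \<theta> 2 \<noteq> pi"
  shows "\<exists>h. periodic n h \<and> excess_form n \<theta> h = 0 \<and> (\<forall>i. bend \<theta> h i \<noteq> 0)"
proof -
  define c where "c = sin (\<theta> 1 + \<theta> 2) / (2 * sin (\<theta> 1))"
  define h where "h i = (if i mod 4 = 2 then 1 else if i mod 4 = 3 then c else 0)" for i :: nat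
  have s: "sin (\<theta> i) \<noteq> 0" for i using sin_pos[of i] by simp
  have s12: "sin (\<theta> 1 + \<theta> 2) \<noteq> 0" using sin_pair_nonzero[of 1] other by (simp add: numeral_2_eq_2)
  have c0: "c \<noteq> 0" using s s12 by (simp add: c_def)
  have t0: "\<theta> 0 = pi - \<theta> 1" and t3: "\<theta> 3 = pi - \<theta> 2" using line total4[OF n] by simp_all
  have per_h: "periodic n h" by (simp add: periodic_def h_def n)
  have hv: "h 0 = 0" "h 1 = 0" "h 2 = 1" "h 3 = c" "h 4 = 0" "h 5 = 0" by (simp_all add: h_def)
  have th4: "\<theta> 4 = \<theta> 0" using periodicD[OF per, of 0] n by simp
  have idx: "Suc 0 = 1" "Suc 1 = 2" "Suc 2 = 3" "Suc 3 = 4" "Suc 4 = 5" by simp_all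
  have sum4: "(\<Sum>i<4. g i) = g 0 + g 1 + g 2 + g 3" for g :: "nat \<Rightarrow> real"
    by (simp add: numeral_eq_Suc)
  have trig: "sin (\<theta> 0) = sin (\<theta> 1)" "sin (\<theta> 3) = sin (\<theta> 2)" "cos (\<theta> 3) = - cos (\<theta> 2)"
    by (simp_all only: t0 t3 sin_pi_minus cos_pi_minus)
  have "excess_form n \<theta> h = c / sin (\<theta> 2) - (cos (\<theta> 1) / sin (\<theta> 1) + cos (\<theta> 2) / sin (\<theta> 2)) / 2"
    unfolding n excess_form_def sum4 idx hv trig
    by (simp add: diff_divide_distrib add_divide_distrib algebra_simps)
  also have "\<dots> = 0"
    using s[of 1] s[of 2] by (simp add: c_def sin_add field_simps)
  finally have null: "excess_form n \<theta> h = 0" .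
  have t23: "\<theta> 2 + \<theta> 3 = pi" using t3 by simp
  have b: "bend \<theta> h 0 = sin (\<theta> 1)" "bend \<theta> h 1 = - sin (\<theta> 1 + \<theta> 2) / 2"
    "bend \<theta> h 2 = sin (\<theta> 3)" "bend \<theta> h 3 = sin (\<theta> 0) * c"
    unfolding bend_def idx hv th4 t23 trig using s[of 1] by (simp_all add: c_def)
  have "bend \<theta> h i \<noteq> 0" if "i < 4" for i
  proof -
    from that have "i = 0 \<or> i = 1 \<or> i = 2 \<or> i = 3" by auto
    then show ?thesis using b s[of 0] s[of 1] s[of 3] c0 s12 by auto
  qed
  then have "bend \<theta> h i \<noteq> 0" for i
    using periodic_mod[OF periodic_bend[OF per_h], of i] n
    by (metis mod_less_divisor zero_less_numeral)
  with null per_h show ?thesis by blast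
qed

text \<open>A bend at \<open>i\<close> sees only the heights \<open>i\<close>, \<open>i + 1\<close>,
  \<open>i + 2\<close>. The other heights are free for building the directions that
  \<open>exists_null_generic\<close> asks for.\<close>

lemma bend_bump:
  assumes "3 \<le> j" "j < n"
  shows "bend \<theta> (bump n (j + i)) i = 0"
proof -
  have "bump n (j + i) (k + i) = 0" if "k < 3" for k
    using that assms unfolding bump_shift by (simp add: bump_def)
  from this[of 0] this[of 1] this[of 2] show ?thesis by (simp add: bend_def)
qed

lemma exists_null_nonbent:
  assumes "\<not> (n = 4 \<and> \<theta> 0 + \<theta> 1 = pi \<and> \<theta> 1 + \<theta> 2 = pi)"
  shows "\<exists>h. periodic n h \<and> excess_form n \<theta> h = 0 \<and> (\<forall>i. bend \<theta> h i \<noteq> 0)"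
proof -
  obtain k where k: "periodic n k" "excess_form n \<theta> k < 0"
    using exists_negative[OF assms] by blast
  \<comment> \<open>With five creases, or four and no straight pair, a free height gives a direction
    for the generic argument. Four creases with exactly one straight line need the explicit
    vector.\<close>
  consider "n \<ge> 5" | "n = 4" "\<theta> 0 + \<theta> 1 \<noteq> pi" "\<theta> 1 + \<theta> 2 \<noteq> pi"
    | "n = 4" "\<theta> 0 + \<theta> 1 = pi" "\<theta> 1 + \<theta> 2 \<noteq> pi" | "n = 4" "\<theta> 0 + \<theta> 1 \<noteq> pi" "\<theta> 1 + \<theta> 2 = pi"
    using n4 assms by linarith
  then show ?thesis
  proof cases
    case 1
    show ?thesis
    proof (rule exists_null_generic[OF k])
      fix i
      let ?d = "\<lambda>a b j. a * bump n (Suc (2 + i)) j + b * bump n (Suc (Suc (2 + i))) j"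
      have "bend \<theta> (?d a b) i = 0" for a b
      proof -
        have "bend \<theta> (?d a b) i
            = a * bend \<theta> (bump n (Suc (2 + i))) i + b * bend \<theta> (bump n (Suc (Suc (2 + i)))) i"
          by (simp add: bend_def algebra_simps)
        then show ?thesis using bend_bump[of 3 i] bend_bump[of 4 i] 1 by (simp add: eval_nat_numeral)
      qed
      moreover have "periodic n (?d a b)" for a b
        using periodic_bump by (simp add: periodic_def)
      \<comment> \<open>Even if both diagonal coefficients vanish, the mixed term does not, so one
        of the choices (1, 0), (0, 1), (1, 1) works.\<close>
      moreover have "\<exists>a b. excess_form n \<theta> (?d a b) \<noteq> 0"
      proof (rule ccontr)
        assume none: "\<not> ?thesis"
        note pair = excess_form_bump_pair[OF disjI1[OF 1]]
        from none have z: "excess_form n \<theta> (?d a b) = 0" for a b by blast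
        show False
          using z[of 1 0, unfolded pair] z[of 0 1, unfolded pair] z[of 1 1, unfolded pair]
            sin_pos[of "2 + i"] sin_pos[of "Suc (2 + i)"] sin_pos[of "Suc (Suc (2 + i))"] by auto
      qed
      ultimately show "\<exists>d. periodic n d \<and> bend \<theta> d i = 0 \<and> excess_form n \<theta> d \<noteq> 0"
        by metis
    qed
  next
    case 2
    have e: "\<theta> 4 = \<theta> 0" "\<theta> 5 = \<theta> 1"
      using periodicD[OF per, of 0] periodicD[OF per, of 1] 2 by simp_all
    have "\<theta> (i mod n) + \<theta> (Suc (i mod n)) \<noteq> pi" for i
    proof -
      have "i mod n < 4" using 2 by simp
      then have "i mod n = 0 \<or> i mod n = 1 \<or> i mod n = 2 \<or> i mod n = 3" by auto
      moreover have "\<theta> 0 + \<theta> 1 \<noteq> pi" "\<theta> 1 + \<theta> 2 \<noteq> pi" "\<theta> 2 + \<theta> 3 \<noteq> pi" "\<theta> 3 + \<theta> 4 \<noteq> pi"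
        using 2 total4 e by auto
      moreover have "Suc 0 = 1" "Suc 1 = 2" "Suc 2 = 3" "Suc 3 = 4" by simp_all
      ultimately show ?thesis by metis
    qed
    moreover have "periodic n (\<lambda>i. \<theta> i + \<theta> (Suc i))"
      using periodicD[OF per, of "Suc i" for i] periodicD[OF per] by (simp add: periodic_def)
    ultimately have ne: "\<theta> i + \<theta> (Suc i) \<noteq> pi" for i
      using periodic_mod[of n "\<lambda>i. \<theta> i + \<theta> (Suc i)" i] by metis
    show ?thesis
    proof (rule exists_null_generic[OF k])
      fix i
      have "excess_form n \<theta> (bump n (Suc (2 + i))) \<noteq> 0"
        using excess_form_bump_pair[of 0 1 "2 + i"] sin_pair_nonzero[OF ne, of "2 + i"]
          sin_pos[of "2 + i"] sin_pos[of "Suc (2 + i)"] by simp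
      moreover have "bend \<theta> (bump n (Suc (2 + i))) i = 0"
        using bend_bump[of 3 i] 2 by (simp add: eval_nat_numeral)
      ultimately show "\<exists>d. periodic n d \<and> bend \<theta> d i = 0 \<and> excess_form n \<theta> d \<noteq> 0"
        using periodic_bump by blast
    qed
  next
    case 3
    then show ?thesis by (rule exists_null_one_line)
  next
    case 4
    interpret s: angle_cycle n "\<lambda>i. \<theta> (i + 1)" by (rule shift)
    have "\<theta> (2 + 1) = 2 * pi - pi - \<theta> 0" using total4 4 by simp
    then obtain h where h: "periodic n h" "excess_form n (\<lambda>i. \<theta> (i + 1)) h = 0"
      "\<And>i. bend (\<lambda>i. \<theta> (i + 1)) h i \<noteq> 0"
      using s.exists_null_one_line 4 total4 by (auto simp: numeral_2_eq_2)
    \<comment> \<open>As \<open>n = 4\<close>, a further shift by 3 undoes the shift by 1.\<close>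
    let ?h = "\<lambda>i. h (i + 3)"
    have th: "\<theta> (i + 3 + 1) = \<theta> i" for i
      using periodicD[OF per, of i] 4 by (simp add: add.commute)
    have "excess_form n (\<lambda>i. \<theta> (i + 3 + 1)) ?h = 0"
      using excess_form_shift[OF s.per h(1), of 3] h(2) by simp
    then have "excess_form n \<theta> ?h = 0" unfolding th by simp
    moreover have "bend \<theta> ?h i = bend (\<lambda>i. \<theta> (i + 1)) h (i + 3)" for i
      using th[of i] th[of "Suc i"] by (simp add: bend_def)
    moreover have "periodic n ?h"
      using periodicD[OF h(1), of "i + 3" for i] by (simp add: periodic_def algebra_simps)
    ultimately show ?thesis using h(3) by metis
  qed
qed

text \<open>Up to a positive factor, the partial derivative of the form in height 1 is the bend at
  the crease of that height. So a null vector with nonzero bends is a regular point of the null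
  cone, and the form changes sign there.\<close>

lemma excess_polar_bump:
  "excess_polar n \<theta> k (bump n 1) = bend \<theta> k 0 / (sin (\<theta> 0) * sin (\<theta> 1))"
proof -
  let ?g = "\<lambda>i. (k i * bump n 1 (Suc i) + bump n 1 i * k (Suc i)
     - cos (\<theta> i) * (k i * bump n 1 i + k (Suc i) * bump n 1 (Suc i))) / sin (\<theta> i)"
  have e: "bump n 1 i = (if i = 1 then 1 else 0)" if "i \<le> n" for i
    using n4 that by (cases "i = n") (auto simp: bump_def)
  have "(\<Sum>i<n. ?g i) = (\<Sum>i<2. ?g i) + (\<Sum>i\<in>{2..<n}. ?g i)"
    using sum.atLeastLessThan_concat[of 0 2 n ?g] n4 unfolding lessThan_atLeast0 by simp
  also have "(\<Sum>i\<in>{2..<n}. ?g i) = 0"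
    by (intro sum.neutral) (auto simp: e[simplified])
  also have "(\<Sum>i<2. ?g i) = ?g 0 + ?g 1"
    by (simp add: numeral_2_eq_2)
  also have "?g 0 = (k 0 - cos (\<theta> 0) * k 1) / sin (\<theta> 0)"
    using n4 by (simp add: e[simplified])
  also have "?g 1 = (k 2 - cos (\<theta> 1) * k 1) / sin (\<theta> 1)"
    using n4 by (simp add: e[simplified] numeral_2_eq_2)
  finally show ?thesis
    using sin_pos[of 0] sin_pos[of 1]
    by (simp add: excess_polar_def bend_def sin_add numeral_2_eq_2 field_simps)
qed

end

section \<open>Folding the creases to prescribed heights\<close>

text \<open>The angle between the projections to the plane of two unit vectors at angle \<alpha>
  whose heights are \<open>sqrt x * a\<close> and \<open>sqrt x * b\<close>. Squared heights are
  linear in \<open>x\<close>, which makes the angle differentiable at \<open>x = 0\<close>.\<close>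

definition shadow_angle :: "real \<Rightarrow> real \<Rightarrow> real \<Rightarrow> real \<Rightarrow> real" where
  "shadow_angle \<alpha> x a b =
     arccos ((cos \<alpha> - x * a * b) / (sqrt (1 - x * a\<^sup>2) * sqrt (1 - x * b\<^sup>2)))"

lemma DERIV_shadow_angle:
  assumes "0 < \<alpha>" "\<alpha> < pi"
  shows "((\<lambda>x. shadow_angle \<alpha> x a b) has_real_derivative
           (a * b - cos \<alpha> * (a\<^sup>2 + b\<^sup>2) / 2) / sin \<alpha>) (at 0)"
proof -
  let ?g = "\<lambda>x. (cos \<alpha> - x * a * b) / (sqrt (1 - x * a\<^sup>2) * sqrt (1 - x * b\<^sup>2))"
  have s: "sin \<alpha> > 0" using assms by (simp add: sin_gt_zero)
  have "(?g has_real_derivative (cos \<alpha> * (a\<^sup>2 + b\<^sup>2) / 2 - a * b)) (at 0)"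
    by (rule derivative_eq_intros refl | simp)+ (simp add: field_simps)
  moreover have "cos \<alpha> < 1" "cos \<alpha> > -1"
    using cos_monotone_0_pi[of 0 \<alpha>] cos_monotone_0_pi[of \<alpha> pi] assms by auto
  ultimately have "((\<lambda>x. arccos (?g x)) has_real_derivative
      inverse (- sqrt (1 - (?g 0)\<^sup>2)) * (cos \<alpha> * (a\<^sup>2 + b\<^sup>2) / 2 - a * b)) (at 0)"
    by (intro DERIV_chain2[where f = arccos] DERIV_arccos) auto
  moreover have "sqrt (1 - (cos \<alpha>)\<^sup>2) = sin \<alpha>"
    using s by (simp add: sin_squared_eq[symmetric])
  moreover have "inverse (- sin \<alpha>) * (cos \<alpha> * (a\<^sup>2 + b\<^sup>2) / 2 - a * b)
      = (a * b - cos \<alpha> * (a\<^sup>2 + b\<^sup>2) / 2) / sin \<alpha>"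
    using s by (simp add: field_simps)
  ultimately show ?thesis
    unfolding shadow_angle_def by simp
qed

lemma shadow_angle_props:
  assumes "\<bar>(cos \<alpha> - x * a * b) / (sqrt (1 - x * a\<^sup>2) * sqrt (1 - x * b\<^sup>2))\<bar> < 1"
    and "x * a\<^sup>2 < 1" "x * b\<^sup>2 < 1" "x \<ge> 0"
  shows "sqrt (1 - x * a\<^sup>2) * sqrt (1 - x * b\<^sup>2) * cos (shadow_angle \<alpha> x a b)
      + (sqrt x * a) * (sqrt x * b) = cos \<alpha>"
proof -
  have "(sqrt x * a) * (sqrt x * b) = (sqrt x * sqrt x) * (a * b)" by (simp only: mult_ac)
  then have "(sqrt x * a) * (sqrt x * b) = x * a * b" using assms(4) by simp
  moreover have "sqrt (1 - x * a\<^sup>2) * sqrt (1 - x * b\<^sup>2) \<noteq> 0"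
    using assms by simp
  moreover have "cos (shadow_angle \<alpha> x a b)
      = (cos \<alpha> - x * a * b) / (sqrt (1 - x * a\<^sup>2) * sqrt (1 - x * b\<^sup>2))"
    unfolding shadow_angle_def using assms(1) by (intro cos_arccos_abs) simp
  ultimately show ?thesis
    by (metis (no_types) diff_add_cancel nonzero_mult_div_cancel_left times_divide_eq_right)
qed

section \<open>Exact closing of the lifted cycle\<close>

context angle_cycle
begin

text \<open>\<open>z i\<close> and \<open>t i\<close> are the horizontal and vertical parts of a
  unit vector. Two parameters are varied: the scale \<open>x\<close> of the squared heights and the
  displacement \<open>s\<close> of a null vector along \<open>e\<close>. For small positive
  \<open>x\<close> the total shadow angle exceeds 2 pi at one \<open>s\<close> and falls short of it
  at the opposite one, so some \<open>s\<close> in between closes the cycle.\<close>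

lemma exists_bent_cycle:
  assumes gen: "\<not> (n = 4 \<and> \<theta> 0 + \<theta> 1 = pi \<and> \<theta> 1 + \<theta> 2 = pi)" and \<eta>: "\<eta> > 0"
  shows "\<exists>z t. periodic n z \<and> periodic n t
    \<and> (\<forall>i. (cmod (z i))\<^sup>2 + (t i)\<^sup>2 = 1)
    \<and> (\<forall>i. z i \<bullet> z (Suc i) + t i * t (Suc i) = cos (\<theta> i))
    \<and> (\<forall>i<n. dist (z i) (cis (\<Sum>j<i. \<theta> j)) < \<eta> \<and> \<bar>t i\<bar> < \<eta>)
    \<and> (\<forall>i. bend \<theta> t i \<noteq> 0)"
proof -
  obtain h\<^sub>0 where h\<^sub>0: "periodic n h\<^sub>0" "excess_form n \<theta> h\<^sub>0 = 0" "\<And>i. bend \<theta> h\<^sub>0 i \<noteq> 0"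
    using exists_null_nonbent[OF gen] by blast
  define c where "c = excess_polar n \<theta> h\<^sub>0 (bump n 1)"
  have c: "c \<noteq> 0"
    using excess_polar_bump[of h\<^sub>0] h\<^sub>0(3)[of 0] sin_pos[of 0] sin_pos[of 1] by (simp add: c_def)
  \<comment> \<open>The factor \<open>c\<close> makes the linear coefficient along \<open>e\<close>
    equal to \<open>c\<^sup>2\<close>, positive whatever the sign of \<open>c\<close>.\<close>
  define e where "e i = c * bump n 1 i" for i
  define H where "H s i = h\<^sub>0 i + s * e i" for s i
  define d where "d = excess_form n \<theta> e"
  have "excess_polar n \<theta> h\<^sub>0 e = c\<^sup>2"
    unfolding e_def excess_polar_def power2_eq_square
    by (subst (3) c_def, unfold excess_polar_def sum_distrib_left)
       (intro sum.cong refl, simp add: algebra_simps)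
  then have QH: "excess_form n \<theta> (H s) = s * (c\<^sup>2 + d * s)" for s
    using excess_form_line[of n \<theta> h\<^sub>0 s e] h\<^sub>0(2)
    by (simp add: H_def[abs_def] d_def power2_eq_square algebra_simps)
  have per_H: "periodic n (H s)" for s
    using h\<^sub>0(1) periodic_bump[of n 1] by (simp add: periodic_def H_def e_def)
  have H_0: "H 0 = h\<^sub>0" by (simp add: H_def fun_eq_iff)

  define \<phi> where "\<phi> x s i = shadow_angle (\<theta> i) x (H s i) (H s (Suc i))" for x s i
  define A where "A x s i = (cos (\<theta> i) - x * H s i * H s (Suc i))
      / (sqrt (1 - x * (H s i)\<^sup>2) * sqrt (1 - x * (H s (Suc i))\<^sup>2))" for x s i
  \<comment> \<open>Projections of the lifted unit vectors, placed one after another by the partial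
    sums of the shadow angles.\<close>
  define Z where "Z x s i = sqrt (1 - x * (H s i)\<^sup>2) *\<^sub>R cis (\<Sum>j<i. \<phi> x s j)" for x s i
  define T where "T x s i = sqrt x * H s i" for x s i
  have \<phi>A: "\<phi> x s i = arccos (A x s i)" for x s i
    by (simp add: \<phi>_def A_def shadow_angle_def)
  have cos_lt: "\<bar>cos (\<theta> i)\<bar> < 1" for i
    using cos_monotone_0_pi[of 0 "\<theta> i"] cos_monotone_0_pi[of "\<theta> i" pi] pos[of i] lt_pi[of i] by auto

  have cH: "isCont (\<lambda>p. H (snd p) i) p" for i and p :: "real \<times> real"
    unfolding H_def by (intro continuous_intros)
  have cA: "isCont (\<lambda>p. A (fst p) (snd p) i) (0, 0)" for i
    unfolding A_def by (intro continuous_intros cH) simp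
  have A_0: "A 0 s i = cos (\<theta> i)" for s i by (simp add: A_def)
  have \<phi>_0: "\<phi> 0 s i = \<theta> i" for s i
    using pos[of i] lt_pi[of i] by (simp add: \<phi>A A_0 arccos_cos)
  have c\<phi>: "isCont (\<lambda>p. \<phi> (fst p) (snd p) i) (0, 0)" for i
    unfolding \<phi>A using cos_lt[of i] by (intro isCont_o2[OF cA isCont_arccos]) (auto simp: A_0)
  have cZ: "isCont (\<lambda>p. Z (fst p) (snd p) i) (0, 0)" for i
    unfolding Z_def cis_conv_exp by (intro continuous_intros cH c\<phi>)
  have cT: "isCont (\<lambda>p. T (fst p) (snd p) i) (0, 0)" for i
    unfolding T_def by (intro continuous_intros cH)

  \<comment> \<open>All requirements on the solution are open conditions at \<open>x = s = 0\<close>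
    and concern finitely many indices, so one radius serves them all.\<close>
  have "\<forall>\<^sub>F p in nhds (0::real, 0::real). \<forall>i\<in>{..<n}.
      \<bar>A (fst p) (snd p) i\<bar> < 1 \<and> fst p * (H (snd p) i)\<^sup>2 < 1 \<and>
      dist (Z (fst p) (snd p) i) (cis (\<Sum>j<i. \<theta> j)) < \<eta> \<and> \<bar>T (fst p) (snd p) i\<bar> < \<eta> \<and>
      bend \<theta> (H (snd p)) i \<noteq> 0 \<and> c\<^sup>2 + d * snd p > 0"
  proof (intro eventually_ball_finite ballI eventually_conj)
    fix i assume "i \<in> {..<n}"
    have tends: "\<forall>\<^sub>F p in nhds (0, 0). g p < b" if "isCont g (0, 0)" "g (0, 0) < b"
      for g :: "real \<times> real \<Rightarrow> real" and b
      using that by (auto simp: isCont_def tendsto_at_iff_tendsto_nhds intro: order_tendstoD)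
    show "\<forall>\<^sub>F p in nhds (0, 0). \<bar>A (fst p) (snd p) i\<bar> < 1"
      using cA by (intro tends continuous_intros) (auto simp: A_0 cos_lt)
    show "\<forall>\<^sub>F p in nhds (0, 0). fst p * (H (snd p) i)\<^sup>2 < 1"
      by (intro tends continuous_intros cH) auto
    show "\<forall>\<^sub>F p in nhds (0, 0). dist (Z (fst p) (snd p) i) (cis (\<Sum>j<i. \<theta> j)) < \<eta>"
      using \<eta> by (intro tends continuous_intros cZ) (auto simp: Z_def \<phi>_0)
    show "\<forall>\<^sub>F p in nhds (0, 0). \<bar>T (fst p) (snd p) i\<bar> < \<eta>"
      using \<eta> by (intro tends continuous_intros cT) (auto simp: T_def)
    have "\<forall>\<^sub>F p in nhds (0::real, 0). - \<bar>bend \<theta> (H (snd p)) i\<bar> < 0"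
      unfolding bend_def using h\<^sub>0(3)[of i]
      by (intro tends continuous_intros cH) (auto simp: H_0 bend_def)
    then show "\<forall>\<^sub>F p in nhds (0::real, 0). bend \<theta> (H (snd p)) i \<noteq> 0"
      by (rule eventually_mono) auto
    have "\<forall>\<^sub>F p in nhds (0::real, 0). - (c\<^sup>2 + d * snd p) < 0"
      using c by (intro tends continuous_intros) auto
    then show "\<forall>\<^sub>F p in nhds (0::real, 0). c\<^sup>2 + d * snd p > 0"
      by (rule eventually_mono) auto
  qed auto
  then obtain \<delta> where \<delta>: "\<delta> > 0" and near: "\<And>x s i. dist (x, s) (0, 0) < \<delta> \<Longrightarrow> i < n \<Longrightarrow>
      \<bar>A x s i\<bar> < 1 \<and> x * (H s i)\<^sup>2 < 1 \<and> dist (Z x s i) (cis (\<Sum>j<i. \<theta> j)) < \<eta> \<and>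
      \<bar>T x s i\<bar> < \<eta> \<and> bend \<theta> (H s) i \<noteq> 0 \<and> c\<^sup>2 + d * s > 0"
    unfolding eventually_nhds_metric by fastforce
  have box: "dist (x, s) (0, 0) < \<delta>" if "\<bar>x\<bar> < \<delta> / 2" "\<bar>s\<bar> < \<delta> / 2" for x s :: real
    using that sqrt_sum_squares_le_sum_abs[of x s] by (simp add: dist_prod_def)
  define s\<^sub>0 where "s\<^sub>0 = \<delta> / 4"
  define G where "G x s = (\<Sum>i<n. \<phi> x s i)" for x s
  have DG: "((\<lambda>x. G x s) has_real_derivative excess_form n \<theta> (H s)) (at 0)" for s
    unfolding G_def \<phi>_def excess_form_def
    by (intro DERIV_sum DERIV_shadow_angle pos lt_pi)
  have G_0: "G 0 s = 2 * pi" for s by (simp add: G_def \<phi>_0 total)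
  have n0: "0 < n" using n4 by simp
  have "excess_form n \<theta> (H s\<^sub>0) > 0"
    using near[OF box n0, of 0 s\<^sub>0] \<delta> by (simp add: QH s\<^sub>0_def)
  then obtain d\<^sub>1 where d\<^sub>1: "d\<^sub>1 > 0" "\<And>x. 0 < x \<Longrightarrow> x < d\<^sub>1 \<Longrightarrow> G x s\<^sub>0 > 2 * pi"
    using DERIV_pos_inc_right[OF DG] by (force simp: G_0)
  have "excess_form n \<theta> (H (- s\<^sub>0)) < 0"
    using near[OF box n0, of 0 "- s\<^sub>0"] \<delta> unfolding QH s\<^sub>0_def by (intro mult_neg_pos) auto
  then obtain d\<^sub>2 where d\<^sub>2: "d\<^sub>2 > 0" "\<And>x. 0 < x \<Longrightarrow> x < d\<^sub>2 \<Longrightarrow> G x (- s\<^sub>0) < 2 * pi"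
    using DERIV_neg_dec_right[OF DG] by (force simp: G_0)
  define x where "x = min (min d\<^sub>1 d\<^sub>2) (\<delta> / 2) / 2"
  have x: "0 < x" "x < d\<^sub>1" "x < d\<^sub>2" "x < \<delta> / 2"
    using d\<^sub>1(1) d\<^sub>2(1) \<delta> by (auto simp: x_def)
  have near_x: "\<bar>A x s i\<bar> < 1" "x * (H s i)\<^sup>2 < 1" "dist (Z x s i) (cis (\<Sum>j<i. \<theta> j)) < \<eta>"
      "\<bar>T x s i\<bar> < \<eta>" "bend \<theta> (H s) i \<noteq> 0" if "\<bar>s\<bar> \<le> s\<^sub>0" "i < n" for s i
    using near[OF box that(2), of x s] x \<delta> that(1) by (auto simp: s\<^sub>0_def)
  \<comment> \<open>The estimates are known for \<open>i < n\<close> only; periodicity extends them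
    to all indices, including \<open>Suc i = n\<close>.\<close>
  have H_mod: "H s (i mod n) = H s i" "H s (Suc (i mod n)) = H s (Suc i)" for s i
    using periodic_mod[OF per_H[of s], of i] periodic_mod[of n "\<lambda>i. H s (Suc i)" i] per_H[of s]
    by (auto simp: periodic_def) (metis add_Suc)
  have x_all: "x * (H s i)\<^sup>2 < 1" if "\<bar>s\<bar> \<le> s\<^sub>0" for s i
    using near_x(2)[OF that, of "i mod n"] n0 by (simp add: H_mod)
  have th_mod: "\<theta> (i mod n) = \<theta> i" for i by (rule periodic_mod[OF per])
  have A_mod: "A x s (i mod n) = A x s i" for s i
    unfolding A_def H_mod th_mod ..
  have A_all: "\<bar>A x s i\<bar> < 1" if "\<bar>s\<bar> \<le> s\<^sub>0" for s i
    using near_x(1)[OF that, of "i mod n"] n0 by (simp add: A_mod)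
  have "continuous_on {- s\<^sub>0..s\<^sub>0} (G x)"
  proof -
    have "continuous_on {- s\<^sub>0..s\<^sub>0} (\<lambda>s. A x s i)" for i
    proof -
      have "sqrt (1 - x * (H s i)\<^sup>2) * sqrt (1 - x * (H s (Suc i))\<^sup>2) \<noteq> 0" if "s \<in> {- s\<^sub>0..s\<^sub>0}" for s
        using x_all[of s i] x_all[of s "Suc i"] that by (simp add: abs_le_iff)
      then show ?thesis unfolding A_def H_def by (intro continuous_intros) blast
    qed
    then show ?thesis
      unfolding G_def \<phi>A
    proof (intro continuous_intros ballI)
      fix i s assume "s \<in> {- s\<^sub>0..s\<^sub>0}"
      then show "- 1 \<le> A x s i \<and> A x s i \<le> 1" using A_all[of s i] by (auto simp: abs_le_iff)
    qed
  qed
  moreover have "G x (- s\<^sub>0) \<le> 2 * pi" "2 * pi \<le> G x s\<^sub>0"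
    using d\<^sub>1(2)[OF x(1,2)] d\<^sub>2(2)[OF x(1,3)] by simp_all
  ultimately obtain s where "- s\<^sub>0 \<le> s" "s \<le> s\<^sub>0" "G x s = 2 * pi"
    using IVT'[of "G x" "- s\<^sub>0" "2 * pi" s\<^sub>0] \<delta> by (force simp: s\<^sub>0_def)
  then have s: "\<bar>s\<bar> \<le> s\<^sub>0" "G x s = 2 * pi" by (simp_all add: abs_le_iff)
  have per_T: "periodic n (T x s)"
    using per_H[of s] by (simp add: periodic_def T_def)
  have per_\<phi>: "periodic n (\<phi> x s)"
    using per_H[of s] periodicD[OF per_H[of s], of "Suc i" for i] per
    by (simp add: periodic_def \<phi>_def)
  \<comment> \<open>Here the total angle 2 pi enters: it is what closes up the fan of
    projections.\<close>
  have "periodic n (Z x s)"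
  proof -
    have "(\<Sum>j<i + n. \<phi> x s j) = (\<Sum>j<i. \<phi> x s j) + 2 * pi" for i
    proof -
      have "(\<Sum>j<i + n. \<phi> x s j) = (\<Sum>j<i. \<phi> x s j) + (\<Sum>j<n. \<phi> x s (j + i))"
        using sum.atLeastLessThan_concat[of 0 i "i + n" "\<phi> x s"]
          sum.shift_bounds_nat_ivl[of "\<phi> x s" 0 i n]
        by (simp add: lessThan_atLeast0 add.commute)
      with sum_periodic_shift[OF per_\<phi>] s(2) show ?thesis by (simp add: G_def)
    qed
    then show ?thesis
      using per_H[of s] by (simp add: periodic_def Z_def cis_mult[symmetric])
  qed
  moreover have "(cmod (Z x s i))\<^sup>2 + (T x s i)\<^sup>2 = 1" for i
    using x_all[OF s(1), of i] x(1) by (simp add: Z_def T_def power_mult_distrib)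
  moreover have "Z x s i \<bullet> Z x s (Suc i) + T x s i * T x s (Suc i) = cos (\<theta> i)" for i
  proof -
    have "cis a \<bullet> cis (a + b) = cos b" for a b
      using cos_diff[of "a + b" a] by (simp add: inner_complex_def mult.commute)
    then have "Z x s i \<bullet> Z x s (Suc i) = sqrt (1 - x * (H s i)\<^sup>2) * sqrt (1 - x * (H s (Suc i))\<^sup>2) * cos (\<phi> x s i)"
      by (simp add: Z_def)
    with shadow_angle_props[OF _ x_all[OF s(1), of i] x_all[OF s(1), of "Suc i"], of "\<theta> i"]
      A_all[OF s(1), of i] x(1) show ?thesis
      by (simp add: A_def \<phi>_def T_def)
  qed
  moreover have "bend \<theta> (T x s) i \<noteq> 0" for i
  proof -
    have "bend \<theta> (T x s) i = sqrt x * bend \<theta> (H s) i"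
      by (simp add: bend_def T_def algebra_simps)
    moreover have "bend \<theta> (H s) i = bend \<theta> (H s) (i mod n)"
      using periodic_mod[OF periodic_bend[OF per_H]] by simp
    ultimately show ?thesis using x(1) near_x(5)[OF s(1), of "i mod n"] n0 by simp
  qed
  ultimately show ?thesis
    using per_T near_x(3,4)[OF s(1)] by blast
qed

end

section \<open>Cyclic order of the creases\<close>

lemma ccw_angle_bounds: "0 \<le> ccw_angle v p x" "ccw_angle v p x < 2 * pi"
  by (simp_all add: ccw_angle_def Arg2pi_ge_0 Arg2pi_lt_2pi)

lemma ccw_angle_self: "ccw_angle v p p = 0"
  using Arg2pi_of_real[of 0] Arg2pi_of_real[of 1] by (cases "p = v") (simp_all add: ccw_angle_def)

lemma ccw_angle_vertex: "ccw_angle v p v = 0"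
  by (simp add: ccw_angle_def)

lemma ccw_angle_change:
  assumes "p \<noteq> v" "x \<noteq> v" "y \<noteq> v"
  shows "ccw_angle v x y = ccw_angle v p y - ccw_angle v p x
           + (if ccw_angle v p x \<le> ccw_angle v p y then 0 else 2 * pi)"
  using Arg2pi_diff[of "(y - v) / (p - v)" "(x - v) / (p - v)"] assms
  by (auto simp: ccw_angle_def)

lemma ccw_angle_flip:
  assumes "p \<noteq> v" "x \<noteq> v" "ccw_angle v p x \<noteq> 0"
  shows "ccw_angle v x p = 2 * pi - ccw_angle v p x"
  using ccw_angle_change[of p v x p] assms ccw_angle_bounds(1)[of v p x] by (simp add: ccw_angle_self)

lemma ccw_angle_eq_0D:
  assumes "p \<noteq> v" "ccw_angle v p x = 0"
  shows "\<exists>t\<ge>0. x - v = of_real t * (p - v)"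
  using assms by (auto simp: ccw_angle_def Arg2pi_eq_0 Reals_def field_simps)

lemma Im_div_pos_iff_ccw_angle:
  "0 < Im ((x - v) / (p - v)) \<longleftrightarrow> 0 < ccw_angle v p x \<and> ccw_angle v p x < pi"
  by (simp add: ccw_angle_def Arg2pi_lt_pi)

text \<open>Were \<open>x\<close> beyond \<open>q\<close>, it would still be in the closed half
  plane to the left of \<open>p\<close>, hence strictly to the left of \<open>q\<close>. But adding
  a nonnegative multiple of \<open>p - v\<close> to one of \<open>q - v\<close> never leads to the
  left of \<open>q\<close>.\<close>

lemma ccw_angle_cone:
  assumes "p \<noteq> v" "q \<noteq> v" "0 < ccw_angle v p q" "ccw_angle v p q < pi" "a \<ge> 0" "b \<ge> 0"
    and x: "x - v = of_real a * (p - v) + of_real b * (q - v)"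
  shows "ccw_angle v p x \<le> ccw_angle v p q"
proof (rule ccontr)
  assume less: "\<not> ?thesis"
  let ?z = "(q - v) / (p - v)"
  have z: "0 < Im ?z" using assms Im_div_pos_iff_ccw_angle by blast
  have xz: "(x - v) / (p - v) = of_real a + of_real b * ?z"
    using assms(1) by (simp add: x add_divide_distrib)
  have "0 \<le> Im ((x - v) / (p - v))"
    unfolding xz using mult_nonneg_nonneg[OF assms(6) less_imp_le[OF z]]
    by (simp del: times_divide_eq_right)
  then have le: "ccw_angle v p x \<le> pi" by (simp add: ccw_angle_def Arg2pi_le_pi)
  have "x \<noteq> v" using less ccw_angle_bounds(1)[of v p q] by (auto simp: ccw_angle_vertex)
  then have "ccw_angle v q x = ccw_angle v p x - ccw_angle v p q"
    using ccw_angle_change[of p v q x] assms(1,2) less by simp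
  then have "0 < ccw_angle v q x" "ccw_angle v q x < pi" using less le assms(3) by simp_all
  then have "0 < Im ((x - v) / (q - v))" using Im_div_pos_iff_ccw_angle by blast
  moreover have "(x - v) / (q - v) = of_real a * inverse ?z + of_real b"
    using assms(2) by (simp add: x add_divide_distrib)
  then have "Im ((x - v) / (q - v)) = a * Im (inverse ?z)"
    by (simp del: inverse_divide)
  moreover have "Im (inverse w) \<le> 0" if "0 < Im w" for w
    using that by (simp add: divide_le_0_iff)
  note mult_nonneg_nonpos[OF assms(5) this[OF z]]
  ultimately show False by linarith
qed

section \<open>The successor map on the creases\<close>

locale crease_fan =
  fixes v :: complex and r :: real and C :: "complex set"
  assumes r: "r > 0" and crease_pattern: "crease_pattern v r C"
begin

lemma finite_C: "finite C" and card_C: "card C > 2" and C_sphere: "C \<subseteq> sphere v r"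
  using crease_pattern by (auto simp: crease_pattern_def)

lemma norm_crease: "p \<in> C \<Longrightarrow> cmod (p - v) = r"
  using C_sphere by (auto simp: dist_norm norm_minus_commute)

lemma crease_ne: "p \<in> C \<Longrightarrow> p \<noteq> v"
  using norm_crease r by force

lemma ccw_angle_inj:
  assumes "p \<in> C" "q \<in> C" "p\<^sub>0 \<noteq> v" "ccw_angle v p\<^sub>0 p = ccw_angle v p\<^sub>0 q"
  shows "p = q"
proof -
  have "ccw_angle v p q = 0"
    using ccw_angle_change[of p\<^sub>0 v p q] assms crease_ne by simp
  then obtain t where t: "t \<ge> 0" "q - v = of_real t * (p - v)"
    using ccw_angle_eq_0D crease_ne assms by blast
  then have "r = t * r"
    using norm_crease[OF assms(1)] norm_crease[OF assms(2)] by (simp add: norm_mult)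
  then show ?thesis using t(2) r by simp
qed

lemma ccw_angle_pos: "p \<in> C \<Longrightarrow> q \<in> C \<Longrightarrow> p \<noteq> q \<Longrightarrow> ccw_angle v p q > 0"
  using ccw_angle_inj[of p q p] ccw_angle_bounds(1)[of v p q] crease_ne[of p]
  by (force simp: ccw_angle_self)

lemma next_crease_exists:
  assumes "p \<in> C"
  shows "\<exists>q. next_crease v C p q"
proof -
  have "card (C - {p}) > 0" using card_C assms by simp
  then have "C - {p} \<noteq> {}" "finite (C - {p})" unfolding card_gt_0_iff by simp_all
  note ne = this
  let ?q = "arg_min_on (ccw_angle v p) (C - {p})"
  have "?q \<in> C - {p}" "\<And>s. s \<in> C - {p} \<Longrightarrow> ccw_angle v p ?q \<le> ccw_angle v p s"
    using arg_min_if_finite(1)[OF ne(2,1)] arg_min_least[OF ne(2,1)] by simp_all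
  then show ?thesis using assms unfolding next_crease_def by blast
qed

lemma next_crease_unique:
  assumes "next_crease v C p q" "next_crease v C p q'"
  shows "q = q'"
  using assms ccw_angle_inj[of q q' p] crease_ne[of p] by (force simp: next_crease_def)

definition nxt :: "complex \<Rightarrow> complex" where
  "nxt p = (SOME q. next_crease v C p q)"

lemma next_crease_nxt: "p \<in> C \<Longrightarrow> next_crease v C p (nxt p)"
  unfolding nxt_def by (rule someI_ex) (rule next_crease_exists)

lemma next_crease_iff: "next_crease v C p q \<longleftrightarrow> p \<in> C \<and> q = nxt p"
  using next_crease_nxt next_crease_unique by (metis next_crease_def)

lemma nxt_props:
  assumes "p \<in> C"
  shows "nxt p \<in> C" "nxt p \<noteq> p" "\<And>s. s \<in> C \<Longrightarrow> s \<noteq> p \<Longrightarrow> ccw_angle v p (nxt p) \<le> ccw_angle v p s"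
  using next_crease_nxt[OF assms] by (auto simp: next_crease_def)

lemma nxt_angle_pos: "p \<in> C \<Longrightarrow> ccw_angle v p (nxt p) > 0"
  using nxt_props(1,2)[of p] by (intro ccw_angle_pos) auto

text \<open>Take the crease of \<open>D\<close> with the smallest angle to \<open>x\<close>. If
  \<open>x\<close> were not before its successor, the successor would have a smaller angle. Allowing
  any successor-closed \<open>D\<close> is what \<open>nxt_closed_eq\<close> needs.\<close>

lemma exists_last_crease:
  assumes "D \<subseteq> C" "D \<noteq> {}" "\<And>p. p \<in> D \<Longrightarrow> nxt p \<in> D" "x \<noteq> v"
  shows "\<exists>p\<in>D. ccw_angle v p x < ccw_angle v p (nxt p)"
proof -
  have "finite D" using assms(1) finite_C finite_subset by blast
  define p where "p = arg_min_on (\<lambda>p. ccw_angle v p x) D"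
  have p: "p \<in> D" "\<And>q. q \<in> D \<Longrightarrow> ccw_angle v p x \<le> ccw_angle v q x"
    using arg_min_if_finite(1)[OF \<open>finite D\<close> assms(2)] arg_min_least[OF \<open>finite D\<close> assms(2)]
    by (auto simp: p_def)
  have pC: "p \<in> C" using p(1) assms(1) by blast
  have "\<not> ccw_angle v p (nxt p) \<le> ccw_angle v p x"
  proof
    assume "ccw_angle v p (nxt p) \<le> ccw_angle v p x"
    then have "ccw_angle v (nxt p) x < ccw_angle v p x"
      using ccw_angle_change[of p v "nxt p" x] nxt_angle_pos[OF pC] crease_ne nxt_props(1)[OF pC] pC assms(4)
      by simp
    then show False using p(2)[OF assms(3)[OF p(1)]] by simp
  qed
  then show ?thesis using p(1) by force
qed

text \<open>For distinct \<open>p\<close> and \<open>q\<close>, the point \<open>x\<close> would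
  come before \<open>q\<close> seen from \<open>p\<close> and before \<open>p\<close> seen from
  \<open>q\<close>, which the change of base ray excludes.\<close>

lemma last_crease_unique:
  assumes "p \<in> C" "q \<in> C" "x \<noteq> v"
    and "ccw_angle v p x < ccw_angle v p (nxt p)" "ccw_angle v q x < ccw_angle v q (nxt q)"
  shows "p = q"
proof (rule ccontr)
  assume "p \<noteq> q"
  have "ccw_angle v p x < ccw_angle v p q" "ccw_angle v q x < ccw_angle v q p"
    using nxt_props(3)[OF assms(1,2)] nxt_props(3)[OF assms(2,1)] \<open>p \<noteq> q\<close> assms(4,5) by auto
  then show False
    using ccw_angle_change[of p v q x] ccw_angle_flip[of p v q] crease_ne assms(1-3)
      ccw_angle_pos[OF assms(1,2) \<open>p \<noteq> q\<close>] ccw_angle_bounds(1)[of v p x] by simp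
qed

text \<open>For a crease \<open>x\<close>, the crease of \<open>D\<close> last before
  \<open>x\<close> must be \<open>x\<close> itself, since no crease lies strictly between a crease
  and its successor. So the successor map has a single orbit.\<close>

lemma nxt_closed_eq:
  assumes "D \<subseteq> C" "D \<noteq> {}" "\<And>p. p \<in> D \<Longrightarrow> nxt p \<in> D"
  shows "D = C"
proof
  show "C \<subseteq> D"
  proof
    fix x assume "x \<in> C"
    with exists_last_crease[OF assms] crease_ne obtain p
      where p: "p \<in> D" "ccw_angle v p x < ccw_angle v p (nxt p)" by blast
    with nxt_props(3)[of p x] \<open>x \<in> C\<close> assms(1) show "x \<in> D" by force
  qed
qed (rule assms)

text \<open>A step to the successor cannot jump over the base crease, so angles from the base add up
  without wrapping. On arrival at the base the sum is 2 pi, whereas \<open>ccw_angle\<close> reads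
  0.\<close>

lemma nxt_step:
  assumes "p \<in> C" "p\<^sub>0 \<in> C"
  shows "ccw_angle v p\<^sub>0 p + ccw_angle v p (nxt p) = (if nxt p = p\<^sub>0 then 2 * pi else ccw_angle v p\<^sub>0 (nxt p))"
proof (cases "p = p\<^sub>0")
  case True
  then show ?thesis using nxt_props(2)[OF assms(1)] by (simp add: ccw_angle_self)
next
  case False
  note ne = crease_ne[OF assms(1)] crease_ne[OF assms(2)] crease_ne[OF nxt_props(1)[OF assms(1)]]
  have f: "ccw_angle v p p\<^sub>0 = 2 * pi - ccw_angle v p\<^sub>0 p"
    using ccw_angle_flip[OF ne(2,1)] ccw_angle_pos[OF assms(2,1)] False by simp
  show ?thesis
  proof (cases "nxt p = p\<^sub>0")
    case True
    then show ?thesis using f by simp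
  next
    case nx: False
    have "ccw_angle v p (nxt p) \<le> ccw_angle v p p\<^sub>0"
      using nxt_props(3)[OF assms] False by simp
    moreover have "ccw_angle v p (nxt p) \<noteq> ccw_angle v p p\<^sub>0"
      using ccw_angle_inj[OF nxt_props(1)[OF assms(1)] assms(2) ne(1)] nx by blast
    ultimately show ?thesis
      using nx f ccw_angle_change[OF ne(2,1,3)] ccw_angle_bounds[of v p\<^sub>0 "nxt p"]
        ccw_angle_bounds[of v p\<^sub>0 p] ccw_angle_bounds(1)[of v p "nxt p"]
      by (auto split: if_splits)
  qed
qed

lemma rotate_nxt:
  assumes "p \<in> C"
  shows "nxt p - v = (p - v) * cis (ccw_angle v p (nxt p))"
proof -
  have "cmod ((nxt p - v) / (p - v)) = 1"
    using norm_crease[OF assms] norm_crease[OF nxt_props(1)[OF assms]] r by (simp add: norm_divide)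
  then have "(nxt p - v) / (p - v) = cis (ccw_angle v p (nxt p))"
    using Arg2pi_eq[of "(nxt p - v) / (p - v)"] by (simp add: ccw_angle_def cis_conv_exp)
  then show ?thesis using crease_ne[OF assms] by (simp add: field_simps)
qed

text \<open>Before the first return to \<open>p\<^sub>0\<close> the angles from
  \<open>p\<^sub>0\<close> are strictly increasing partial sums, so the iterates are distinct and
  finiteness forces a return. The iterates up to the first return are closed under successors, hence
  exhaust the creases, and the returning step completes the sum to 2 pi.\<close>

lemma cyclic_enumeration:
  fixes u :: "nat \<Rightarrow> complex" and \<theta> :: "nat \<Rightarrow> real"
  assumes "p\<^sub>0 \<in> C"
  defines "u \<equiv> \<lambda>i. (nxt ^^ i) p\<^sub>0"
  defines "\<theta> \<equiv> \<lambda>i. ccw_angle v (u i) (u (Suc i))"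
  shows "periodic (card C) u" "bij_betw u {..<card C} C" "\<And>i. u i \<in> C" "\<And>i. u (Suc i) = nxt (u i)"
    "(\<Sum>i<card C. \<theta> i) = 2 * pi"
    "\<And>i. u i - v = (p\<^sub>0 - v) * cis (\<Sum>j<i. \<theta> j)"
proof -
  show uS: "u (Suc i) = nxt (u i)" for i by (simp add: u_def)
  show uC: "u i \<in> C" for i
    by (induction i) (use assms(1) nxt_props(1) in \<open>auto simp: u_def\<close>)
  have \<theta>_pos: "\<theta> i > 0" for i using nxt_angle_pos[OF uC] by (simp add: \<theta>_def uS)
  have ang: "ccw_angle v p\<^sub>0 (u i) = (\<Sum>j<i. \<theta> j)" if "\<And>j. 0 < j \<Longrightarrow> j \<le> i \<Longrightarrow> u j \<noteq> p\<^sub>0" for i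
    using that
  proof (induction i)
    case 0
    then show ?case by (simp add: u_def ccw_angle_self)
  next
    case (Suc i)
    then have "nxt (u i) \<noteq> p\<^sub>0" using uS[of i] by (metis order_refl zero_less_Suc)
    with Suc show ?case using nxt_step[OF uC[of i] assms(1)] uS[of i] by (simp add: \<theta>_def)
  qed
  have inj: "inj_on u {..<m}" if "\<And>j. 0 < j \<Longrightarrow> j < m \<Longrightarrow> u j \<noteq> p\<^sub>0" for m
  proof -
    have "strict_mono (\<lambda>i. \<Sum>j<i. \<theta> j)" by (simp add: strict_mono_Suc_iff \<theta>_pos)
    then have "inj (\<lambda>i. \<Sum>j<i. \<theta> j)" by (rule strict_mono_imp_inj_on)
    moreover have "ccw_angle v p\<^sub>0 (u i) = (\<Sum>j<i. \<theta> j)" if "i < m" for i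
      by (rule ang) (use that \<open>\<And>j. 0 < j \<Longrightarrow> j < m \<Longrightarrow> u j \<noteq> p\<^sub>0\<close> in auto)
    ultimately show ?thesis unfolding inj_on_def by (metis UNIV_I lessThan_iff)
  qed
  have "\<exists>m>0. u m = p\<^sub>0"
  proof (rule ccontr)
    assume "\<not> ?thesis"
    then have "inj_on u {..<Suc (card C)}" by (intro inj) (metis)
    then show False
      using card_inj_on_le[of u "{..<Suc (card C)}" C] finite_C uC by auto
  qed
  define m where "m = (LEAST m. 0 < m \<and> u m = p\<^sub>0)"
  have m: "0 < m" "u m = p\<^sub>0" using LeastI_ex[OF \<open>\<exists>m>0. u m = p\<^sub>0\<close>] by (auto simp: m_def)
  have least: "u j \<noteq> p\<^sub>0" if "0 < j" "j < m" for j using not_less_Least that by (force simp: m_def)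
  have "u ` {..<m} = C"
  proof (rule nxt_closed_eq)
    show "nxt p \<in> u ` {..<m}" if "p \<in> u ` {..<m}" for p
    proof -
      from that obtain i where i: "i < m" "p = u i" by auto
      show ?thesis
      proof (cases "Suc i = m")
        case True
        then have "nxt p = u 0" using i m uS[of i] by (simp add: u_def)
        then show ?thesis using m(1) by blast
      next
        case False
        then show ?thesis using i uS[of i] by (metis Suc_lessI imageI lessThan_iff)
      qed
    qed
  qed (use uC m in auto)
  then have bij: "bij_betw u {..<m} C" using inj least by (simp add: bij_betw_def)
  then have mC: "m = card C" using bij_betw_same_card by fastforce
  with bij show "bij_betw u {..<card C} C" by simp
  show "periodic (card C) u"
    using m(2) unfolding mC by (simp add: periodic_def u_def funpow_add)
  obtain k where k: "m = Suc k" using m(1) gr0_implies_Suc by blast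
  have "(\<Sum>j<m. \<theta> j) = ccw_angle v p\<^sub>0 (u k) + ccw_angle v (u k) (nxt (u k))"
    using ang[of k] least k by (simp add: \<theta>_def uS)
  also have "\<dots> = 2 * pi"
    using nxt_step[OF uC[of k] assms(1)] m(2) uS[of k] k by simp
  finally show "(\<Sum>i<card C. \<theta> i) = 2 * pi" by (simp add: mC)
  show "u i - v = (p\<^sub>0 - v) * cis (\<Sum>j<i. \<theta> j)" for i
  proof (induction i)
    case (Suc i)
    then show ?case using rotate_nxt[OF uC[of i]] by (simp add: uS \<theta>_def cis_mult[symmetric])
  qed (simp add: u_def)
qed

end

section \<open>Necessity\<close>

definition cross2 :: "complex \<Rightarrow> complex \<Rightarrow> real" where
  "cross2 a b = Im (cnj a * b)"

text \<open>Cramer's rule, first proved without denominators.\<close>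

lemma cross2_decomposition:
  assumes "cross2 a b \<noteq> 0"
  shows "z = (cross2 z b / cross2 a b) *\<^sub>R a + (cross2 a z / cross2 a b) *\<^sub>R b"
proof -
  have "cross2 a b *\<^sub>R z = cross2 z b *\<^sub>R a + cross2 a z *\<^sub>R b"
    by (simp add: cross2_def complex_eq_iff algebra_simps)
  then have "(1 / cross2 a b) *\<^sub>R (cross2 a b *\<^sub>R z)
      = (1 / cross2 a b) *\<^sub>R (cross2 z b *\<^sub>R a + cross2 a z *\<^sub>R b)" by simp
  then show ?thesis using assms by (simp add: scaleR_add_right)
qed

lemma bounded_linear_cross2: "bounded_linear (\<lambda>z. cross2 z b)" "bounded_linear (\<lambda>z. cross2 a z)"
  unfolding cross2_def
  by (intro bounded_linear_compose[OF bounded_linear_Im] bounded_linear_mult_const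
      bounded_linear_const_mult bounded_linear_cnj bounded_linear_ident)+

lemma cross2_eq_Im_div: "cross2 a b = (cmod a)\<^sup>2 * Im (b / a)"
  by (cases "a = 0") (simp_all add: cross2_def Im_complex_div_eq_0 complex_div_cnj[of b a] mult.commute Im_divide_of_real)

lemma cross2_eq_0_norm_eq:
  assumes "cross2 a b = 0" "cmod a = cmod b"
  shows "b = a \<or> b = - a"
proof (cases "a = 0")
  case False
  then have "Im (b / a) = 0" using assms(1) by (simp add: cross2_eq_Im_div)
  then have "b / a \<in> \<real>" by (simp add: complex_is_Real_iff)
  then obtain t where t: "b / a = of_real t" by (auto simp: Reals_def)
  then have "\<bar>t\<bar> = 1" using assms(2) False by (metis divide_self norm_divide norm_eq_zero norm_of_real)
  then show ?thesis using t False by (auto simp: abs_if field_simps split: if_splits)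
qed (use assms in auto)

lemma linear_combination_of_gram:
  fixes X A B :: "'a::real_inner" and x a b :: "'b::real_inner"
  assumes "X \<bullet> X = x \<bullet> x" "X \<bullet> A = x \<bullet> a" "X \<bullet> B = x \<bullet> b" "A \<bullet> A = a \<bullet> a" "A \<bullet> B = a \<bullet> b" "B \<bullet> B = b \<bullet> b"
    and x: "x = \<alpha> *\<^sub>R a + \<beta> *\<^sub>R b"
  shows "X = \<alpha> *\<^sub>R A + \<beta> *\<^sub>R B"
proof -
  have expand: "(y - (\<alpha> *\<^sub>R c + \<beta> *\<^sub>R d)) \<bullet> (y - (\<alpha> *\<^sub>R c + \<beta> *\<^sub>R d))
      = y \<bullet> y - 2 * \<alpha> * (y \<bullet> c) - 2 * \<beta> * (y \<bullet> d) + \<alpha>\<^sup>2 * (c \<bullet> c) + 2 * \<alpha> * \<beta> * (c \<bullet> d) + \<beta>\<^sup>2 * (d \<bullet> d)"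
    for y c d :: "'c::real_inner"
    by (simp add: inner_diff_left inner_diff_right inner_add_left inner_add_right
        inner_commute[of c y] inner_commute[of d y] inner_commute[of d c] power2_eq_square algebra_simps)
  have "(X - (\<alpha> *\<^sub>R A + \<beta> *\<^sub>R B)) \<bullet> (X - (\<alpha> *\<^sub>R A + \<beta> *\<^sub>R B))
      = (x - (\<alpha> *\<^sub>R a + \<beta> *\<^sub>R b)) \<bullet> (x - (\<alpha> *\<^sub>R a + \<beta> *\<^sub>R b))"
    unfolding expand assms(1-6) ..
  then show ?thesis using x by simp
qed

section \<open>Faces as a finite closed cover of the disk\<close>

context crease_fan
begin

abbreviation face :: "complex \<Rightarrow> complex set" where
  "face p \<equiv> sector v r p (nxt p)"

lemma faces_eq: "faces v r C = face ` C"
  by (auto simp: faces_def next_crease_iff)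

lemma closed_face: "closed (face p)"
proof -
  have "closed ((\<lambda>x. (x - v) / (p - v)) -` {z. Arg2pi z \<le> ccw_angle v p (nxt p)})"
    by (intro closed_vimage closed_Arg2pi2pi_le) (simp add: divide_inverse, intro continuous_intros)
  then have "closed (cball v r \<inter> (\<lambda>x. (x - v) / (p - v)) -` {z. Arg2pi z \<le> ccw_angle v p (nxt p)})"
    by (intro closed_Int closed_cball)
  moreover have "face p = cball v r \<inter> (\<lambda>x. (x - v) / (p - v)) -` {z. Arg2pi z \<le> ccw_angle v p (nxt p)}"
    by (auto simp: sector_def ccw_angle_def)
  ultimately show ?thesis by simp
qed

lemma crease_in_cball: "p \<in> C \<Longrightarrow> p \<in> cball v r"
  using C_sphere by auto

lemma in_face:
  assumes "p \<in> C"
  shows "v \<in> face p" "p \<in> face p" "nxt p \<in> face p"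
  using assms r nxt_props(1)[OF assms] crease_in_cball
  by (auto simp: sector_def ccw_angle_vertex ccw_angle_self ccw_angle_bounds)

lemma in_some_face:
  assumes "x \<in> cball v r"
  shows "\<exists>p\<in>C. x \<in> face p"
proof (cases "x = v")
  case True
  then show ?thesis using in_face(1) card_C by (metis card.empty ex_in_conv not_less_zero)
next
  case False
  have "C \<noteq> {}" using card_C by auto
  then show ?thesis
    using exists_last_crease[OF order_refl _ nxt_props(1) False] assms
    by (fastforce simp: sector_def)
qed

text \<open>The disk is convex, so the bound can be glued along the segment from \<open>a\<close> to
  \<open>b\<close>, whose parameter interval is covered by the closed preimages of the faces. It
  serves both for contraction of a folding and for closeness to the flat embedding.\<close>

lemma lipschitz_from_faces:
  fixes f :: "complex \<Rightarrow> 'b::metric_space"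
  assumes "M \<ge> 0" "\<And>p. p \<in> C \<Longrightarrow> M-lipschitz_on (face p) f"
  shows "M-lipschitz_on (cball v r) f"
proof (rule lipschitz_onI[OF _ assms(1)])
  fix a b assume ab: "a \<in> cball v r" "b \<in> cball v r"
  let ?\<gamma> = "\<lambda>t::real. a + t *\<^sub>R (b - a)"
  let ?U = "\<lambda>p. ?\<gamma> -` face p"
  have seg: "?\<gamma> t \<in> cball v r" if "0 \<le> t" "t \<le> 1" for t
    using convexD_alt[OF convex_cball ab that] by (simp add: algebra_simps)
  have "(M * dist a b)-lipschitz_on {0..1} (f \<circ> ?\<gamma>)"
  proof (rule lipschitz_on_closed_Union[where I = C and U = ?U])
    show "(M * dist a b)-lipschitz_on (?U p) (f \<circ> ?\<gamma>)" if "p \<in> C" for p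
    proof (rule lipschitz_onI)
      fix s t assume st: "s \<in> ?U p" "t \<in> ?U p"
      have "?\<gamma> s - ?\<gamma> t = (s - t) *\<^sub>R (b - a)" by (simp add: algebra_simps)
      then have "dist (?\<gamma> s) (?\<gamma> t) = dist s t * dist a b"
        by (simp only: dist_norm norm_scaleR) (simp add: norm_minus_commute)
      then show "dist ((f \<circ> ?\<gamma>) s) ((f \<circ> ?\<gamma>) t) \<le> M * dist a b * dist s t"
        using lipschitz_onD[OF assms(2)[OF that], of "?\<gamma> s" "?\<gamma> t"] st by (simp add: mult_ac)
    qed (use assms(1) in simp)
    show "closed (?U p)" for p
      by (intro closed_vimage closed_face continuous_intros)
    show "{0..1} \<subseteq> (\<Union>p\<in>C. ?U p)"
    proof
      fix t :: real assume "t \<in> {0..1}"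
      then show "t \<in> (\<Union>p\<in>C. ?U p)" using in_some_face[OF seg[of t]] by auto
    qed
  qed (use finite_C assms(1) in auto)
  from lipschitz_onD[OF this, of 0 1] show "dist (f a) (f b) \<le> M * dist a b"
    by simp
qed

lemma cross2_nxt_pos:
  assumes "p \<in> C" "ccw_angle v p (nxt p) < pi"
  shows "cross2 (p - v) (nxt p - v) > 0"
  using Im_div_pos_iff_ccw_angle[of "nxt p" v p] nxt_angle_pos[OF assms(1)] assms(2) crease_ne[OF assms(1)]
  by (simp add: cross2_eq_Im_div)

text \<open>Otherwise \<open>a\<close> and \<open>b\<close> would both be followed by the third
  crease \<open>c\<close>, and \<open>c\<close> with its successor would be closed under successors,
  with at most two elements.\<close>

lemma adjacent_of_card_3:
  assumes "card C = 3" "a \<in> C" "b \<in> C"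
  shows "a = b \<or> nxt a = b \<or> nxt b = a"
proof (rule ccontr)
  assume not: "\<not> ?thesis"
  then have "card (C - {a, b}) = 1" using assms by (simp add: card_Diff_subset)
  then obtain c where "C - {a, b} = {c}" using card_1_singletonE by blast
  then have C: "C = {a, b, c}" and c: "c \<noteq> a" "c \<noteq> b" using assms(2,3) by blast+
  have n: "nxt a = c" "nxt b = c" "nxt c \<in> {a, b}"
    using nxt_props(1,2)[of a] nxt_props(1,2)[of b] nxt_props(1,2)[of c] not C by auto
  then have "{nxt c, c} = C"
    using C by (intro nxt_closed_eq) auto
  moreover have "card {nxt c, c} \<le> 2" by (simp add: card_insert_if)
  ultimately show False using assms(1) by simp
qed

end

section \<open>Obstructions to a rigid folding\<close>

locale rigid_folding = crease_fan +
  fixes f :: "complex \<Rightarrow> real^3"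
  assumes origami: "rigid_origami v r C f"
begin

definition img :: "complex \<Rightarrow> real^3" where
  "img x = f x - f v"

text \<open>The pairs for which the isometry on a face gives the inner product of the images, see
  \<open>img_inner\<close>.\<close>

definition share_face :: "complex \<Rightarrow> complex \<Rightarrow> bool" where
  "share_face x y \<longleftrightarrow> (\<exists>p\<in>C. x \<in> face p \<and> y \<in> face p)"

lemma share_face_sym: "share_face x y \<Longrightarrow> share_face y x"
  by (auto simp: share_face_def)

lemma share_face_nxt: "p \<in> C \<Longrightarrow> share_face p (nxt p)"
  using in_face by (auto simp: share_face_def)

lemma share_face_self: "x \<in> cball v r \<Longrightarrow> share_face x x"
  using in_some_face by (auto simp: share_face_def)

lemma img_inner:
  assumes "share_face x y"
  shows "img x \<bullet> img y = (x - v) \<bullet> (y - v)"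
proof -
  from assms obtain p where p: "p \<in> C" "x \<in> face p" "y \<in> face p" by (auto simp: share_face_def)
  have iso: "dist (f s) (f t) = dist s t" if "s \<in> face p" "t \<in> face p" for s t
    using origami that p(1) by (auto simp: rigid_origami_def faces_eq)
  have "norm (img x) = norm (x - v)" "norm (img y) = norm (y - v)"
    using iso[OF p(2) in_face(1)[OF p(1)]] iso[OF p(3) in_face(1)[OF p(1)]]
    by (simp_all add: img_def dist_norm)
  moreover have "norm (img x - img y) = norm ((x - v) - (y - v))"
    using iso[OF p(2,3)] by (simp add: img_def dist_norm)
  ultimately show ?thesis by (simp only: dot_norm_neg)
qed

lemma norm_img: "x \<in> cball v r \<Longrightarrow> norm (img x) = norm (x - v)"
  using img_inner[OF share_face_self] by (simp add: norm_eq_sqrt_inner)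

lemma img_combination:
  assumes "share_face x p" "share_face x q" "share_face p q"
    "x \<in> cball v r" "p \<in> cball v r" "q \<in> cball v r"
    and x: "x - v = a *\<^sub>R (p - v) + b *\<^sub>R (q - v)"
  shows "img x = a *\<^sub>R img p + b *\<^sub>R img q"
  by (rule linear_combination_of_gram[OF _ _ _ _ _ _ x])
     (intro img_inner assms share_face_self)+

lemma contraction: "x \<in> cball v r \<Longrightarrow> y \<in> cball v r \<Longrightarrow> norm (img x - img y) \<le> norm (x - y)"
proof -
  have "1-lipschitz_on (cball v r) f"
    using origami by (intro lipschitz_from_faces lipschitz_onI) (auto simp: rigid_origami_def faces_eq)
  then show "x \<in> cball v r \<Longrightarrow> y \<in> cball v r \<Longrightarrow> norm (img x - img y) \<le> norm (x - y)"
    using lipschitz_onD[of 1 "cball v r" f x y] by (simp add: img_def dist_norm)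
qed

lemma not_differentiable_crease: "p \<in> C \<Longrightarrow> \<not> f differentiable (at p within cball v r)"
  using origami by (auto simp: rigid_origami_def crease_def set_eq_iff)

text \<open>
  A straight image of a diameter pins \<open>img x \<bullet> img a\<close> for every \<open>x\<close> of the disk, because \<open>f\<close> is a
  contraction; near a crease off the diameter, \<open>f\<close> is then given by one affine formula.
\<close>

lemma no_straight_diameter:
  assumes a: "a \<in> sphere v r" and b: "b \<in> sphere v r"
    and ab: "b - v = - (a - v)" and img_ab: "img b = - img a"
  shows False
proof -
  have cb: "a \<in> cball v r" "b \<in> cball v r" using a b by auto
  have pin: "img x \<bullet> img a = (x - v) \<bullet> (a - v)" if x: "x \<in> cball v r" for x
  proof -
    \<comment> \<open>Lengths from the vertex are preserved, so shorter distances mean larger inner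
      products. Taking \<open>y\<close> to be \<open>a\<close> and its antipode \<open>b\<close>
      gives both inequalities.\<close>
    have ge: "(x - v) \<bullet> (y - v) \<le> img x \<bullet> img y" if "y \<in> cball v r" for y
    proof -
      have "(norm (img x - img y))\<^sup>2 \<le> (norm ((x - v) - (y - v)))\<^sup>2"
        using contraction[OF x that] by (intro power_mono) auto
      then show ?thesis
        by (simp add: dot_norm_neg norm_img[OF x] norm_img[OF that])
    qed
    from ge[OF cb(1)] ge[OF cb(2)] show ?thesis
      by (simp add: ab img_ab inner_minus_right del: minus_diff_eq)
  qed
  have "\<not> C \<subseteq> {a, b}"
    using card_mono[of "{a, b}" C] card_C card_insert_le_m1[of 2 "{b}" a] by auto
  then obtain p where p: "p \<in> C" "p \<noteq> a" "p \<noteq> b" by blast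
  define u w where "u = a - v" and "w = p - v"
  have norms: "cmod u = cmod w"
    using a norm_crease[OF p(1)] by (simp add: u_def w_def dist_norm norm_minus_commute)
  have "w \<noteq> u" "w \<noteq> - u" using p ab by (auto simp: u_def w_def)
  then have cr: "cross2 u w \<noteq> 0" using cross2_eq_0_norm_eq norms by blast
  \<comment> \<open>Coordinates in the basis \<open>u\<close>, \<open>w\<close>. The points
    \<open>a\<close> and \<open>p\<close> need not share a face; \<open>pin\<close> supplies the
    inner products with \<open>img a\<close> that the Gram argument requires.\<close>
  define g where "g x = f v + ((cross2 (x - v) w / cross2 u w) *\<^sub>R img a
      + (cross2 u (x - v) / cross2 u w) *\<^sub>R img p)" for x
  have g: "f x = g x" if x: "x \<in> cball v r" "share_face x p" for x
  proof -
    let ?\<alpha> = "cross2 (x - v) w / cross2 u w" and ?\<beta> = "cross2 u (x - v) / cross2 u w"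
    have pc: "p \<in> cball v r" by (rule crease_in_cball[OF p(1)])
    have "img x = ?\<alpha> *\<^sub>R img a + ?\<beta> *\<^sub>R img p"
    proof (rule linear_combination_of_gram[where x = "x - v" and a = u and b = w])
      show "img a \<bullet> img p = u \<bullet> w"
        using pin[OF pc] by (simp add: u_def w_def inner_commute)
    qed (use pin[OF x(1)] pin[OF cb(1)] img_inner[OF x(2)] img_inner[OF share_face_self[OF x(1)]]
          img_inner[OF share_face_self[OF pc]] cross2_decomposition[OF cr] in \<open>simp_all add: u_def w_def\<close>)
    moreover have "f x = f v + img x" by (simp add: img_def)
    ultimately show ?thesis by (simp only: g_def)
  qed
  have "g differentiable (at p within cball v r)"
  proof -
    have bl: "bounded_linear (\<lambda>z. (cross2 z w / cross2 u w) *\<^sub>R img a + (cross2 u z / cross2 u w) *\<^sub>R img p)"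
      by (intro bounded_linear_add bounded_linear_scaleR_left[THEN bounded_linear_compose]
          bounded_linear_divide[THEN bounded_linear_compose] bounded_linear_cross2)
    have "((\<lambda>x. x - v) has_derivative (\<lambda>x. x)) (at p within cball v r)"
      using has_derivative_diff[OF has_derivative_ident has_derivative_const] by simp
    from has_derivative_add[OF has_derivative_const bounded_linear.has_derivative[OF bl this]]
    show ?thesis unfolding g_def by (rule differentiableI)
  qed
  \<comment> \<open>The finitely many faces that miss \<open>p\<close> form a closed set, so near
    \<open>p\<close> every point of the disk shares a face with \<open>p\<close>.\<close>
  moreover have "\<exists>d>0. \<forall>x\<in>cball v r. dist x p < d \<longrightarrow> share_face x p"
  proof -
    have "open (- (\<Union>q\<in>{q \<in> C. p \<notin> face q}. face q))"
      using finite_C closed_face by (intro open_Compl closed_UN) auto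
    then obtain d where "d > 0" "\<And>x. dist x p < d \<Longrightarrow> x \<notin> (\<Union>q\<in>{q \<in> C. p \<notin> face q}. face q)"
      using open_dist by (metis (no_types, lifting) ComplD ComplI UN_E mem_Collect_eq)
    then show ?thesis using in_some_face unfolding share_face_def by blast
  qed
  then obtain d where "d > 0" "\<And>x. x \<in> cball v r \<Longrightarrow> dist x p < d \<Longrightarrow> share_face x p" by blast
  ultimately have "f differentiable (at p within cball v r)"
    using differentiable_transform_within[of g p "cball v r" d f] g crease_in_cball[OF p(1)] by metis
  then show False using not_differentiable_crease[OF p(1)] by contradiction
qed

text \<open>Two vectors of length \<open>r\<close> with inner product \<open>- r\<^sup>2\<close> are
  opposite, so the diameter would stay straight.\<close>

lemma no_antipodal_sharing:
  assumes "p \<in> C" "q \<in> cball v r" "q - v = - (p - v)" "img q \<bullet> img p = - r\<^sup>2"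
  shows False
proof -
  have n: "norm (img q) = r" "norm (img p) = r"
    using norm_img[OF assms(2)] norm_img[OF crease_in_cball[OF assms(1)]] norm_crease[OF assms(1)]
    by (simp_all add: assms(3) del: minus_diff_eq)
  have "img q \<bullet> img q = r\<^sup>2" "img p \<bullet> img p = r\<^sup>2"
    by (simp_all add: n flip: power2_norm_eq_inner)
  then have "(img q + img p) \<bullet> (img q + img p) = 0"
    using assms(4) by (simp add: inner_add_left inner_add_right inner_commute[of "img p" "img q"])
  then have "img q + img p = 0" by simp
  then have "img q = - img p" by (simp add: eq_neg_iff_add_eq_0)
  moreover have "q \<in> sphere v r"
    using norm_crease[OF assms(1)] assms(3) by (simp add: dist_norm norm_minus_commute)
  ultimately show False
    using no_straight_diameter[of p q] assms C_sphere by auto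
qed

lemma inner_antipode: "p \<in> C \<Longrightarrow> q - v = - (p - v) \<Longrightarrow> (q - v) \<bullet> (p - v) = - r\<^sup>2"
  using norm_crease[of p] by (simp add: power2_norm_eq_inner[symmetric] del: minus_diff_eq)

lemma antipode_in_cball: "p \<in> C \<Longrightarrow> 2 * v - p \<in> cball v r"
  using norm_crease[of p] by (simp add: dist_norm)

text \<open>Otherwise the antipode of \<open>p\<close> lies in the face starting at
  \<open>p\<close>, and the isometry of that face keeps a diameter straight.\<close>

lemma sector_angle_lt_pi:
  assumes "p \<in> C"
  shows "ccw_angle v p (nxt p) < pi"
proof (rule ccontr)
  let ?q = "2 * v - p"
  assume "\<not> ?thesis"
  moreover have "(?q - v) / (p - v) = -1"
    using crease_ne[OF assms] by (simp add: field_simps)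
  then have "ccw_angle v p ?q = pi" unfolding ccw_angle_def using Arg2pi_of_real[of "-1"] by simp
  ultimately have "?q \<in> face p" using antipode_in_cball[OF assms] by (simp add: sector_def)
  then have "share_face ?q p" using assms in_face by (auto simp: share_face_def)
  from img_inner[OF this] show False
    using no_antipodal_sharing[OF assms antipode_in_cball[OF assms]] inner_antipode[OF assms, of ?q] by simp
qed

lemma face_combination:
  assumes "p \<in> C" "a \<ge> 0" "b \<ge> 0" "a + b \<le> 1"
  defines "x \<equiv> v + (a *\<^sub>R (p - v) + b *\<^sub>R (nxt p - v))"
  shows "x \<in> cball v r" "img x = a *\<^sub>R img p + b *\<^sub>R img (nxt p)"
proof -
  have xv: "x - v = a *\<^sub>R (p - v) + b *\<^sub>R (nxt p - v)" by (simp add: x_def)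
  have "norm (x - v) \<le> a * r + b * r"
    unfolding xv using assms(2,3) norm_crease[OF assms(1)] norm_crease[OF nxt_props(1)[OF assms(1)]]
    by (metis abs_of_nonneg norm_scaleR norm_triangle_ineq)
  also have "\<dots> \<le> r" using assms(4) r by (metis distrib_right mult_left_le_one_le add_nonneg_nonneg assms(2,3) less_imp_le)
  finally show xc: "x \<in> cball v r" by (simp add: dist_norm norm_minus_commute)
  have "ccw_angle v p x \<le> ccw_angle v p (nxt p)"
    using xv assms(2,3) crease_ne[OF assms(1)] crease_ne[OF nxt_props(1)[OF assms(1)]]
      nxt_angle_pos[OF assms(1)] sector_angle_lt_pi[OF assms(1)]
    by (intro ccw_angle_cone[where a = a and b = b]) (auto simp: scaleR_conv_of_real)
  then have "x \<in> face p" using xc by (simp add: sector_def)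
  then have "share_face x p" "share_face x (nxt p)" using in_face[OF assms(1)] assms(1)
    by (auto simp: share_face_def)
  then show "img x = a *\<^sub>R img p + b *\<^sub>R img (nxt p)"
    using share_face_nxt[OF assms(1)] xc crease_in_cball assms(1) nxt_props(1)[OF assms(1)] xv
    by (intro img_combination) auto
qed

lemma combination_injective:
  assumes "p \<in> C" "q \<in> C" "a > 0" "b > 0"
    and "a *\<^sub>R img p + b *\<^sub>R img (nxt p) = a *\<^sub>R img q + b *\<^sub>R img (nxt q)"
  shows "a *\<^sub>R (p - v) + b *\<^sub>R (nxt p - v) = a *\<^sub>R (q - v) + b *\<^sub>R (nxt q - v)"
proof -
  \<comment> \<open>Scaling by \<open>1 / (a + b)\<close> brings both combinations into the disk,
    where \<open>face_combination\<close> and injectivity apply.\<close>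
  define c where "c = 1 / (a + b)"
  have c: "c > 0" "c * a \<ge> 0" "c * b \<ge> 0" "c * a + c * b \<le> 1"
    using assms(3,4) by (simp_all add: c_def field_simps)
  let ?x = "\<lambda>p. v + ((c * a) *\<^sub>R (p - v) + (c * b) *\<^sub>R (nxt p - v))"
  have "img (?x p) = c *\<^sub>R (a *\<^sub>R img p + b *\<^sub>R img (nxt p))"
    "img (?x q) = c *\<^sub>R (a *\<^sub>R img q + b *\<^sub>R img (nxt q))"
    using face_combination(2)[OF assms(1) c(2-4)] face_combination(2)[OF assms(2) c(2-4)]
    by (simp_all add: scaleR_add_right)
  then have "img (?x p) = img (?x q)" by (simp only: assms(5))
  then have "f (?x p) = f (?x q)" by (simp add: img_def)
  then have "?x p = ?x q"
    using face_combination(1)[OF assms(1) c(2-4)] face_combination(1)[OF assms(2) c(2-4)] origami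
    unfolding rigid_origami_def by (metis inj_onD)
  then have "c *\<^sub>R (a *\<^sub>R (p - v) + b *\<^sub>R (nxt p - v)) = c *\<^sub>R (a *\<^sub>R (q - v) + b *\<^sub>R (nxt q - v))"
    by (simp add: scaleR_add_right)
  then show ?thesis using c(1) by simp
qed

text \<open>Any two of three creases bound a common face, so all their inner products are preserved.
  Expanding the antipode of \<open>p\<close> in the two creases of its face then gives its image the
  flat inner product with \<open>img p\<close>, and a diameter stays straight.\<close>

lemma card_ne_3: "card C \<noteq> 3"
proof
  assume 3: "card C = 3"
  obtain p where p: "p \<in> C" using card_C by (metis card.empty ex_in_conv not_less_zero)
  let ?x = "2 * v - p"
  have xc: "?x \<in> cball v r" by (rule antipode_in_cball[OF p])
  then obtain q where q: "q \<in> C" "?x \<in> face q" using in_some_face by blast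
  have sC: "nxt q \<in> C" by (rule nxt_props(1)[OF q(1)])
  have sh: "share_face s p" if "s \<in> C" for s
    using adjacent_of_card_3[OF 3 that p] share_face_nxt[OF p] share_face_nxt[OF that]
      share_face_self[OF crease_in_cball[OF p]] share_face_sym by metis
  obtain a b where ab: "?x - v = a *\<^sub>R (q - v) + b *\<^sub>R (nxt q - v)"
    using cross2_decomposition[of "q - v" "nxt q - v" "?x - v"] cross2_nxt_pos[OF q(1) sector_angle_lt_pi[OF q(1)]]
    by (metis less_irrefl)
  have "share_face ?x q" "share_face ?x (nxt q)" using in_face[OF q(1)] q by (auto simp: share_face_def)
  then have "img ?x = a *\<^sub>R img q + b *\<^sub>R img (nxt q)"
    using share_face_nxt[OF q(1)] xc crease_in_cball q(1) sC ab by (intro img_combination) auto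
  then have "img ?x \<bullet> img p = (?x - v) \<bullet> (p - v)"
    unfolding ab by (simp add: inner_add_left img_inner[OF sh[OF q(1)]] img_inner[OF sh[OF sC]])
  then show False
    using no_antipodal_sharing[OF p xc] inner_antipode[OF p, of ?x] by simp
qed

lemma collinear_creases_antipodal:
  assumes "p \<in> C" "q \<in> C" "p \<noteq> q" "collinear (crease v p \<union> crease v q)"
  shows "q - v = - (p - v)"
proof -
  from assms(4) obtain u where u: "\<And>x y. x \<in> crease v p \<union> crease v q \<Longrightarrow> y \<in> crease v p \<union> crease v q
      \<Longrightarrow> \<exists>c. x - y = c *\<^sub>R u"
    unfolding collinear_def by blast
  obtain c d where "p - v = c *\<^sub>R u" "q - v = d *\<^sub>R u"
    using u[of p v] u[of q v] by (auto simp: crease_def)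
  then have "cross2 (p - v) (q - v) = 0" by (simp add: cross2_def)
  then have "q - v = p - v \<or> q - v = - (p - v)"
    using cross2_eq_0_norm_eq norm_crease assms(1,2) by blast
  with assms(3) show ?thesis by auto
qed

text \<open>If the part of \<open>d\<close> orthogonal to \<open>e\<close> were nonzero, it would
  complete \<open>s\<close>, \<open>t\<close>, \<open>e\<close> to four independent vectors in
  three-dimensional space.\<close>

lemma orthogonal_pair_parallel:
  fixes s t d e :: "real^3"
  assumes "s \<noteq> 0" "t \<noteq> 0" "e \<noteq> 0" "s \<bullet> t = 0" "d \<bullet> s = 0" "d \<bullet> t = 0" "e \<bullet> s = 0" "e \<bullet> t = 0"
  shows "\<exists>k. d = k *\<^sub>R e"
proof (rule exI, rule ccontr)
  let ?k = "(d \<bullet> e) / (e \<bullet> e)"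
  let ?z = "d - ?k *\<^sub>R e"
  assume "d \<noteq> ?k *\<^sub>R e"
  then have z: "?z \<noteq> 0" by simp
  have o: "?z \<bullet> s = 0" "?z \<bullet> t = 0" "?z \<bullet> e = 0"
    using assms by (simp_all add: inner_diff_left)
  have "independent {s, t, e, ?z}"
  proof (rule pairwise_orthogonal_independent)
    show "pairwise orthogonal {s, t, e, ?z}"
      using assms o by (auto simp: pairwise_def orthogonal_def inner_commute)
  qed (use assms z in auto)
  then have "card {s, t, e, ?z} \<le> 3"
    using independent_bound[of "{s, t, e, ?z}"] by simp
  moreover have "s \<noteq> t" "s \<noteq> e" "s \<noteq> ?z" "t \<noteq> e" "t \<noteq> ?z" "e \<noteq> ?z"
    using assms o z by (metis inner_eq_zero_iff)+
  ultimately show False by simp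
qed

text \<open>The preserved inner products make the two sums of opposite images orthogonal to each
  other and to both differences. The sums are nonzero since neither line stays straight, so in space
  the differences are parallel. This yields a common point in the images of two opposite
  faces.\<close>

lemma not_unspecified_cross: "\<not> unspecified_cross v C"
proof
  assume "unspecified_cross v C"
  then obtain p1 p2 p3 p4 where C: "C = {p1, p2, p3, p4}" "card C = 4"
    and n: "next_crease v C p1 p2" "next_crease v C p2 p3" "next_crease v C p3 p4" "next_crease v C p4 p1"
    and col: "collinear (crease v p1 \<union> crease v p3)" "collinear (crease v p2 \<union> crease v p4)"
    unfolding unspecified_cross_def by blast
  have mem: "p1 \<in> C" "p2 \<in> C" "p3 \<in> C" "p4 \<in> C" using C by auto
  have dist: "p1 \<noteq> p2" "p1 \<noteq> p3" "p1 \<noteq> p4" "p2 \<noteq> p3" "p2 \<noteq> p4" "p3 \<noteq> p4"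
    using C by (auto simp: card_insert_if split: if_splits)
  have nx: "nxt p1 = p2" "nxt p2 = p3" "nxt p3 = p4" "nxt p4 = p1"
    using n by (simp_all add: next_crease_iff)
  have a3: "p3 - v = - (p1 - v)" and a4: "p4 - v = - (p2 - v)"
    using collinear_creases_antipodal mem dist col by blast+
  define c where "c = (p1 - v) \<bullet> (p2 - v)"
  have i: "img p1 \<bullet> img p2 = c" "img p2 \<bullet> img p3 = - c" "img p3 \<bullet> img p4 = c" "img p4 \<bullet> img p1 = - c"
    using img_inner[OF share_face_nxt[OF mem(1)]] img_inner[OF share_face_nxt[OF mem(2)]]
      img_inner[OF share_face_nxt[OF mem(3)]] img_inner[OF share_face_nxt[OF mem(4)]]
    by (simp_all add: nx a3 a4 c_def inner_commute del: minus_diff_eq)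
  have nn: "img p \<bullet> img p = r\<^sup>2" if "p \<in> C" for p
    using norm_img[OF crease_in_cball[OF that]] norm_crease[OF that] by (simp flip: power2_norm_eq_inner)
  let ?s = "img p1 + img p3" and ?t = "img p2 + img p4"
  let ?d = "img p1 - img p3" and ?e = "img p2 - img p4"
  have s: "?s \<noteq> 0" and t: "?t \<noteq> 0"
    using no_straight_diameter[OF _ _ a3] no_straight_diameter[OF _ _ a4] mem C_sphere
    by (metis add.commute add_eq_0_iff subsetD)+
  have de: "?d \<noteq> 0" "?e \<noteq> 0"
    using origami dist crease_in_cball mem by (auto simp: rigid_origami_def inj_on_def img_def)
  have "\<exists>k. ?d = k *\<^sub>R ?e"
    using i nn[OF mem(1)] nn[OF mem(2)] nn[OF mem(3)] nn[OF mem(4)]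
    by (intro orthogonal_pair_parallel[OF s t de(2)])
       (simp_all add: inner_add_left inner_add_right inner_diff_left inner_diff_right inner_commute)
  then obtain k where k: "?d = k *\<^sub>R ?e" ..
  have "k \<noteq> 0" using k de by auto
  \<comment> \<open>Rearranged with positive coefficients, the relation equates image points of the
    faces starting at \<open>p4\<close> and \<open>p2\<close> for positive \<open>k\<close>, and at
    \<open>p1\<close> and \<open>p3\<close> for negative \<open>k\<close>.\<close>
  then consider "k > 0" | "- k > 0" by linarith
  then have "p1 - v = k *\<^sub>R (p2 - v)"
  proof cases
    case 1
    have "k *\<^sub>R img p4 + 1 *\<^sub>R img (nxt p4) = k *\<^sub>R img p2 + 1 *\<^sub>R img (nxt p2)"
      using k by (simp add: nx algebra_simps)
    from combination_injective[OF mem(4,2) 1 _ this]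
    have "k *\<^sub>R (- (p2 - v)) + (p1 - v) = k *\<^sub>R (p2 - v) + - (p1 - v)"
      by (simp add: nx a3 a4 del: minus_diff_eq)
    then show ?thesis by (simp add: complex_eq_iff algebra_simps)
  next
    case 2
    have "1 *\<^sub>R img p1 + (- k) *\<^sub>R img (nxt p1) = 1 *\<^sub>R img p3 + (- k) *\<^sub>R img (nxt p3)"
      using k by (simp add: nx algebra_simps)
    from combination_injective[OF mem(1,3) _ 2 this]
    have "(p1 - v) + (- k) *\<^sub>R (p2 - v) = - (p1 - v) + (- k) *\<^sub>R (- (p2 - v))"
      by (simp add: nx a3 a4 del: minus_diff_eq)
    then show ?thesis by (simp add: complex_eq_iff algebra_simps)
  qed
  then have par: "p1 - v = k *\<^sub>R (p2 - v)" .
  then have "r = \<bar>k\<bar> * r"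
    using norm_crease[OF mem(1)] norm_crease[OF mem(2)] by (metis norm_scaleR)
  then have "k = 1 \<or> k = -1" using r by (auto simp: abs_if split: if_splits)
  then have "p1 - v = p2 - v \<or> p1 - v = p4 - v" using par a4 by auto
  then show False using dist by auto
qed

end

section \<open>Sufficiency\<close>

definition space_point :: "complex \<Rightarrow> real \<Rightarrow> real^3" where
  "space_point z t = vector [Re z, Im z, t]"

lemma space_point_inner: "space_point z s \<bullet> space_point w t = z \<bullet> w + s * t"
  by (simp add: space_point_def inner_vec_def sum_3 inner_complex_def)

lemma space_point_diff: "space_point (z - w) (s - t) = space_point z s - space_point w t"
  by (simp add: space_point_def vec_eq_iff forall_3)

lemma space_point_3: "space_point z t $ 3 = t"
  by (simp add: space_point_def)

lemma norm_space_point: "norm (space_point z t) = sqrt ((cmod z)\<^sup>2 + t\<^sup>2)"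
  by (simp add: norm_eq_sqrt_inner[of "space_point z t"] space_point_inner power2_norm_eq_inner
      power2_eq_square[of t])

lemma abs_cross2_le: "\<bar>cross2 a b\<bar> \<le> cmod a * cmod b"
  unfolding cross2_def using abs_Im_le_cmod[of "cnj a * b"] by (simp add: norm_mult)

lemma cross2_self: "cross2 a a = 0"
  by (simp add: cross2_def)

text \<open>Applied to the heights of three lifted creases, the left side becomes
  \<open>bend\<close>; this is what links bends to linearity across a crease.\<close>

lemma three_directions_relation:
  "sin b *\<^sub>R z - sin (a + b) *\<^sub>R (z * cis a) + sin a *\<^sub>R (z * cis a * cis b) = 0"
proof -
  have "of_real (sin b) - of_real (sin (a + b)) * cis a + of_real (sin a) * (cis a * cis b) = 0"
    unfolding cis_mult complex_eq_iff
    by (simp add: sin_add cos_add algebra_simps)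
       (use sin_cos_squared_add[of a] in algebra)
  then have "z * (of_real (sin b) - of_real (sin (a + b)) * cis a + of_real (sin a) * (cis a * cis b)) = 0"
    by simp
  then show ?thesis by (simp add: scaleR_conv_of_real algebra_simps)
qed

text \<open>The chain rule on the closed unit interval and uniqueness of one-sided derivatives
  suffice. The one-sided form is needed at the boundary circle and for segments starting on a
  crease.\<close>

lemma derivative_along_segment:
  fixes f :: "'a::real_normed_vector \<Rightarrow> 'b::real_normed_vector"
  assumes D: "(f has_derivative D) (at x within S)"
    and seg: "\<And>s. 0 \<le> s \<Longrightarrow> s \<le> 1 \<Longrightarrow> x + s *\<^sub>R d \<in> S \<and> f (x + s *\<^sub>R d) = f x + s *\<^sub>R c"
  shows "D d = c"
proof -
  let ?g = "\<lambda>s::real. x + s *\<^sub>R d"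
  have "(?g has_derivative (\<lambda>s. s *\<^sub>R d)) (at 0 within {0..1})"
    by (auto intro!: derivative_eq_intros)
  moreover have "(f has_derivative D) (at (?g 0) within ?g ` {0..1})"
    using seg by (auto intro: has_derivative_subset[OF D])
  ultimately have "((\<lambda>s. f (?g s)) has_derivative (\<lambda>s. D (s *\<^sub>R d))) (at 0 within {0..1})"
    using has_derivative_in_compose by fastforce
  then have "((\<lambda>s. f (?g s)) has_vector_derivative D d) (at 0 within {0..1})"
    using linear_scale[OF has_derivative_linear[OF D]] by (simp add: has_vector_derivative_def)
  moreover have "((\<lambda>s. f x + s *\<^sub>R c) has_vector_derivative c) (at 0 within {0..1})"
    by (auto intro!: derivative_eq_intros)
  then have "((\<lambda>s. f (?g s)) has_vector_derivative c) (at 0 within {0..1})"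
    by (rule has_vector_derivative_transform[rotated 2]) (use seg in auto)
  ultimately show ?thesis
    using vector_derivative_unique_within_closed_interval[of 0 1 0 "\<lambda>s. f (?g s)"] by auto
qed

section \<open>Construction of the folded disk\<close>

context crease_fan
begin

lemma collinear_antipodal_creases:
  assumes "q - v = - (p - v)"
  shows "collinear (crease v p \<union> crease v q)"
proof -
  have "\<exists>t. x = v + t *\<^sub>R (p - v)" if "x \<in> crease v p \<union> crease v q" for x
  proof -
    from that obtain t where "x = v + t *\<^sub>R (p - v) \<or> x = v + t *\<^sub>R (q - v)"
      by (auto simp: crease_def in_segment algebra_simps)
    then have "x = v + t *\<^sub>R (p - v) \<or> x = v + (- t) *\<^sub>R (p - v)"
      by (simp add: assms del: minus_diff_eq)
    then show ?thesis by blast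
  qed
  then have "\<exists>c. x - y = c *\<^sub>R (p - v)"
    if "x \<in> crease v p \<union> crease v q" "y \<in> crease v p \<union> crease v q" for x y
    using that by (metis add_diff_cancel_left scaleR_left_diff_distrib)
  then show ?thesis unfolding collinear_def by blast
qed

text \<open>This is \<open>exists_bent_cycle\<close> carried over from the unit circle to the
  creases. Excluding a linear map on three consecutive creases says that the middle one is really
  folded.\<close>

lemma exists_frame:
  assumes n4: "card C \<ge> 4" and lt_pi: "\<And>p. p \<in> C \<Longrightarrow> ccw_angle v p (nxt p) < pi"
    and no_cross: "\<not> unspecified_cross v C" and \<epsilon>: "\<epsilon> > 0"
  shows "\<exists>W. \<forall>p\<in>C. W p \<bullet> W p = (p - v) \<bullet> (p - v) \<and> W p \<bullet> W (nxt p) = (p - v) \<bullet> (nxt p - v)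
    \<and> norm (W p - space_point (p - v) 0) \<le> \<epsilon>
    \<and> (\<nexists>D. linear D \<and> D (p - v) = W p \<and> D (nxt p - v) = W (nxt p)
           \<and> D (nxt (nxt p) - v) = W (nxt (nxt p)))"
proof -
  define n where "n = card C"
  obtain p\<^sub>0 where p\<^sub>0: "p\<^sub>0 \<in> C" using card_C by (metis card.empty ex_in_conv not_less_zero)
  define u where "u i = (nxt ^^ i) p\<^sub>0" for i
  define \<theta> where "\<theta> i = ccw_angle v (u i) (u (Suc i))" for i
  have per_u: "periodic n u" and bij: "bij_betw u {..<n} C" and uC: "\<And>i. u i \<in> C"
    and uS: "\<And>i. u (Suc i) = nxt (u i)" and total: "(\<Sum>i<n. \<theta> i) = 2 * pi"
    and u_cis: "\<And>i. u i - v = (p\<^sub>0 - v) * cis (\<Sum>j<i. \<theta> j)"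
    using cyclic_enumeration[OF p\<^sub>0] unfolding u_def \<theta>_def n_def by blast+
  interpret angle_cycle n \<theta>
  proof
    show "periodic n \<theta>"
      using periodicD[OF per_u] periodicD[OF per_u, of "Suc i" for i] by (simp add: periodic_def \<theta>_def)
  qed (use n4 total nxt_angle_pos[OF uC] lt_pi[OF uC] in \<open>simp_all add: n_def \<theta>_def uS\<close>)
  have "\<not> (n = 4 \<and> \<theta> 0 + \<theta> 1 = pi \<and> \<theta> 1 + \<theta> 2 = pi)"
  proof
    assume *: "n = 4 \<and> \<theta> 0 + \<theta> 1 = pi \<and> \<theta> 1 + \<theta> 2 = pi"
    have "u 2 - v = - (u 0 - v)" "u 3 - v = - (u 1 - v)"
    proof -
      have "u 2 - v = (p\<^sub>0 - v) * cis (\<theta> 0 + \<theta> 1)"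
        using u_cis[of 2] by (simp add: numeral_2_eq_2)
      then show "u 2 - v = - (u 0 - v)" using * u_cis[of 0] by simp
      have "cis (\<theta> 1 + \<theta> 2) = -1" using * by simp
      then have "cis (\<theta> 1) * cis (\<theta> 2) = -1" by (simp only: cis_mult)
      then show "u 3 - v = - (u 1 - v)"
        using u_cis[of 1] u_cis[of 3]
        by (simp add: numeral_2_eq_2 numeral_3_eq_3 mult.assoc flip: cis_mult)
    qed
    then have "collinear (crease v (u 0) \<union> crease v (u 2))" "collinear (crease v (u 1) \<union> crease v (u 3))"
      by (intro collinear_antipodal_creases; simp)+
    moreover have "{..<4::nat} = {0, 1, 2, 3}" by auto
    then have "C = {u 0, u 1, u 2, u 3}"
      using bij * by (simp add: bij_betw_def)
    moreover have step: "next_crease v C (u i) (u (Suc i))" for i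
      using next_crease_nxt[OF uC] by (simp add: uS)
    have "next_crease v C (u 0) (u 1)" "next_crease v C (u 1) (u 2)"
      "next_crease v C (u 2) (u 3)" "next_crease v C (u 3) (u 4)"
      using step[of 0] step[of 1] step[of 2] step[of 3] by (simp_all add: eval_nat_numeral)
    moreover have "u 4 = u 0" using periodicD[OF per_u, of 0] * by simp
    ultimately have "unspecified_cross v C"
      using * unfolding unspecified_cross_def n_def by metis
    with no_cross show False by contradiction
  qed
  then obtain z t where per_z: "periodic n z" and per_t: "periodic n t"
    and unit: "\<And>i. (cmod (z i))\<^sup>2 + (t i)\<^sup>2 = 1"
    and gram: "\<And>i. z i \<bullet> z (Suc i) + t i * t (Suc i) = cos (\<theta> i)"
    and close: "\<And>i. i < n \<Longrightarrow> dist (z i) (cis (\<Sum>j<i. \<theta> j)) < \<epsilon> / (2 * r) \<and> \<bar>t i\<bar> < \<epsilon> / (2 * r)"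
    and bent: "\<And>i. bend \<theta> t i \<noteq> 0"
    using exists_bent_cycle[of "\<epsilon> / (2 * r)"] \<epsilon> r by auto
  \<comment> \<open>Multiplication by \<open>p\<^sub>0 - v\<close> and by \<open>r\<close> scales
    the unit model and turns it onto the creases. The error \<open>\<epsilon> / (2 * r)\<close>
    enters twice, in the plane and in height.\<close>
  define W' where "W' i = space_point ((p\<^sub>0 - v) * z i) (r * t i)" for i
  have per_W': "periodic n W'" using per_z per_t by (simp add: periodic_def W'_def)
  define W where "W p = W' (inv_into {..<n} u p)" for p
  have W_u: "W (u i) = W' i" for i
  proof -
    have "i mod n < n" using n4 by (simp add: n_def)
    then have "inv_into {..<n} u (u i) = i mod n"
      using bij_betw_inv_into_left[OF bij, of "i mod n"] periodic_mod[OF per_u, of i] by simp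
    then show ?thesis by (simp add: W_def periodic_mod[OF per_W'])
  qed
  have mult_inner: "((p\<^sub>0 - v) * a) \<bullet> ((p\<^sub>0 - v) * b) = r\<^sup>2 * (a \<bullet> b)" for a b
  proof -
    have "(c * a) \<bullet> (c * b) = (cmod c)\<^sup>2 * (a \<bullet> b)" for c
      unfolding cmod_power2 by (simp add: inner_complex_def algebra_simps power2_eq_square)
    then show ?thesis using norm_crease[OF p\<^sub>0] by simp
  qed
  have cis_inner: "cis a \<bullet> cis (a + b) = cos b" for a b
    using cos_diff[of "a + b" a] by (simp add: inner_complex_def mult.commute)
  have 1: "W' i \<bullet> W' i = (u i - v) \<bullet> (u i - v)" for i
  proof -
    have "W' i \<bullet> W' i = r\<^sup>2 * ((cmod (z i))\<^sup>2 + (t i)\<^sup>2)"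
      unfolding W'_def space_point_inner mult_inner power2_norm_eq_inner
      by (simp add: power2_eq_square algebra_simps)
    then show ?thesis
      using unit[of i] norm_crease[OF uC[of i]] by (simp flip: power2_norm_eq_inner)
  qed
  have 2: "W' i \<bullet> W' (Suc i) = (u i - v) \<bullet> (u (Suc i) - v)" for i
  proof -
    have "W' i \<bullet> W' (Suc i) = r\<^sup>2 * (z i \<bullet> z (Suc i) + t i * t (Suc i))"
      unfolding W'_def space_point_inner mult_inner by (simp add: power2_eq_square algebra_simps)
    then show ?thesis by (simp add: gram u_cis mult_inner cis_inner)
  qed
  have 3: "norm (W' i - space_point (u i - v) 0) \<le> \<epsilon>" if "i < n" for i
  proof -
    have "W' i - space_point (u i - v) 0
        = space_point ((p\<^sub>0 - v) * (z i - cis (\<Sum>j<i. \<theta> j))) (r * t i)"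
      unfolding W'_def u_cis space_point_diff[symmetric] by (simp add: algebra_simps)
    also have "norm \<dots> \<le> cmod ((p\<^sub>0 - v) * (z i - cis (\<Sum>j<i. \<theta> j))) + \<bar>r * t i\<bar>"
      unfolding norm_space_point by (metis norm_ge_zero power2_abs sqrt_sum_squares_le_sum abs_ge_zero)
    also have "\<dots> = r * (dist (z i) (cis (\<Sum>j<i. \<theta> j)) + \<bar>t i\<bar>)"
      using norm_crease[OF p\<^sub>0] r by (simp add: norm_mult dist_norm abs_mult distrib_left)
    also have "\<dots> \<le> r * (\<epsilon> / (2 * r) + \<epsilon> / (2 * r))"
      using close[OF that] r by (intro mult_left_mono) auto
    also have "\<dots> = \<epsilon>" using r by simp
    finally show ?thesis .
  qed
  have 4: "\<not> (linear D \<and> D (u i - v) = W' i \<and> D (u (Suc i) - v) = W' (Suc i)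
      \<and> D (u (Suc (Suc i)) - v) = W' (Suc (Suc i)))" for i D
  proof
    assume D: "linear D \<and> D (u i - v) = W' i \<and> D (u (Suc i) - v) = W' (Suc i)
      \<and> D (u (Suc (Suc i)) - v) = W' (Suc (Suc i))"
    let ?a = "\<theta> i" and ?b = "\<theta> (Suc i)"
    have "u (Suc i) - v = (u i - v) * cis ?a" "u (Suc (Suc i)) - v = (u i - v) * cis ?a * cis ?b"
      by (simp_all add: u_cis cis_mult[symmetric] mult.assoc)
    then have rel: "sin ?b *\<^sub>R (u i - v) - sin (?a + ?b) *\<^sub>R (u (Suc i) - v)
        + sin ?a *\<^sub>R (u (Suc (Suc i)) - v) = 0"
      using three_directions_relation[of ?b "u i - v" ?a] by simp
    have "sin ?b *\<^sub>R W' i - sin (?a + ?b) *\<^sub>R W' (Suc i) + sin ?a *\<^sub>R W' (Suc (Suc i))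
        = D (sin ?b *\<^sub>R (u i - v) - sin (?a + ?b) *\<^sub>R (u (Suc i) - v) + sin ?a *\<^sub>R (u (Suc (Suc i)) - v))"
      using D by (simp only: linear_add linear_diff linear_scale)
    also have "\<dots> = 0" using D by (simp only: rel linear_0)
    \<comment> \<open>The third coordinate of this combination is
      \<open>r * bend \<theta> t i\<close>.\<close>
    finally have "(sin ?b *\<^sub>R W' i - sin (?a + ?b) *\<^sub>R W' (Suc i) + sin ?a *\<^sub>R W' (Suc (Suc i))) $ 3 = 0"
      by simp
    then have "r * bend \<theta> t i = 0"
      by (simp add: W'_def space_point_3 bend_def algebra_simps)
    then show False using r bent by simp
  qed
  show ?thesis
  proof (intro exI[of _ W] ballI)
    fix p assume "p \<in> C"
    then obtain i where i: "i < n" "p = u i" using bij by (auto simp: bij_betw_def)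
    have nx: "nxt p = u (Suc i)" "nxt (nxt p) = u (Suc (Suc i))" by (simp_all add: i uS)
    show "W p \<bullet> W p = (p - v) \<bullet> (p - v) \<and> W p \<bullet> W (nxt p) = (p - v) \<bullet> (nxt p - v)
      \<and> norm (W p - space_point (p - v) 0) \<le> \<epsilon>
      \<and> (\<nexists>D. linear D \<and> D (p - v) = W p \<and> D (nxt p - v) = W (nxt p)
           \<and> D (nxt (nxt p) - v) = W (nxt (nxt p)))"
      unfolding nx(2) unfolding nx(1) unfolding i(2) W_u using 1 2 3[OF i(1)] 4 by blast
  qed
qed

lemma nxt_surj: "q \<in> C \<Longrightarrow> \<exists>p\<in>C. nxt p = q"
proof -
  assume "q \<in> C"
  have "nxt ` C = C"
    by (rule nxt_closed_eq) (use nxt_props(1) \<open>q \<in> C\<close> in auto)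
  with \<open>q \<in> C\<close> show ?thesis by (metis imageE)
qed

text \<open>The map extends the frame linearly over each face. It differs from the flat embedding by
  a (1/2)-Lipschitz map, hence is injective. A derivative on a crease would agree with the linear
  maps of both adjacent faces, which the frame forbids.\<close>

lemma rigidly_foldableI:
  assumes n4: "card C \<ge> 4" and lt_pi: "\<And>p. p \<in> C \<Longrightarrow> ccw_angle v p (nxt p) < pi"
    and no_cross: "\<not> unspecified_cross v C"
  shows "rigidly_foldable v r C"
proof -
  have C_ne: "C \<noteq> {}" using card_C by auto
  define area where "area p = cross2 (p - v) (nxt p - v)" for p
  have area_pos: "area p > 0" if "p \<in> C" for p
    using cross2_nxt_pos[OF that lt_pi[OF that]] by (simp add: area_def)
  define \<mu> where "\<mu> = Min (area ` C)"
  have \<mu>: "\<mu> > 0" "\<And>p. p \<in> C \<Longrightarrow> \<mu> \<le> area p"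
    using finite_C C_ne area_pos by (auto simp: \<mu>_def)
  \<comment> \<open>In Cramer's rule the coefficients of \<open>z\<close> are at most
    \<open>cmod z * r / \<mu>\<close>, so errors of \<open>\<mu> / (4 * r)\<close> at two creases
    add up to at most \<open>cmod z / 2\<close>.\<close>
  have "\<mu> / (4 * r) > 0" using \<mu> r by simp
  from exists_frame[OF n4 lt_pi no_cross this] obtain W where
    W_norm: "\<And>p. p \<in> C \<Longrightarrow> W p \<bullet> W p = (p - v) \<bullet> (p - v)"
    and W_inner: "\<And>p. p \<in> C \<Longrightarrow> W p \<bullet> W (nxt p) = (p - v) \<bullet> (nxt p - v)"
    and W_close: "\<And>p. p \<in> C \<Longrightarrow> norm (W p - space_point (p - v) 0) \<le> \<mu> / (4 * r)"
    and W_bent: "\<And>p D. p \<in> C \<Longrightarrow> linear D \<Longrightarrow> D (p - v) = W p \<Longrightarrow> D (nxt p - v) = W (nxt p)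
           \<Longrightarrow> D (nxt (nxt p) - v) \<noteq> W (nxt (nxt p))"
    by metis
  define M where "M p z = (cross2 z (nxt p - v) / area p) *\<^sub>R W p + (cross2 (p - v) z / area p) *\<^sub>R W (nxt p)" for p z
  have M_linear: "bounded_linear (M p)" for p
    unfolding M_def[abs_def]
    by (intro bounded_linear_add bounded_linear_scaleR_left[THEN bounded_linear_compose]
          bounded_linear_divide[THEN bounded_linear_compose] bounded_linear_cross2)
  have M_crease: "M p (p - v) = W p" "M p (nxt p - v) = W (nxt p)" if "p \<in> C" for p
    using area_pos[OF that] by (simp_all add: M_def area_def cross2_self)
  have decompose: "z = (cross2 z (nxt p - v) / area p) *\<^sub>R (p - v) + (cross2 (p - v) z / area p) *\<^sub>R (nxt p - v)"
    if "p \<in> C" for p z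
    using cross2_decomposition area_pos[OF that] unfolding area_def by (metis less_irrefl)
  have M_norm: "norm (M p z) = cmod z" if p: "p \<in> C" for p z
  proof -
    let ?a = "cross2 z (nxt p - v) / area p" and ?b = "cross2 (p - v) z / area p"
    have nC: "nxt p \<in> C" by (rule nxt_props(1)[OF p])
    have sq: "(a *\<^sub>R x + b *\<^sub>R y) \<bullet> (a *\<^sub>R x + b *\<^sub>R y) = a\<^sup>2 * (x \<bullet> x) + 2 * a * b * (x \<bullet> y) + b\<^sup>2 * (y \<bullet> y)"
      for a b and x y :: "'c::real_inner"
      by (simp add: inner_add_left inner_add_right inner_commute[of y x] power2_eq_square algebra_simps)
    have "M p z \<bullet> M p z = (?a *\<^sub>R (p - v) + ?b *\<^sub>R (nxt p - v)) \<bullet> (?a *\<^sub>R (p - v) + ?b *\<^sub>R (nxt p - v))"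
      unfolding M_def sq W_norm[OF p] W_norm[OF nC] W_inner[OF p] ..
    then show ?thesis
      unfolding decompose[OF p, symmetric] by (simp add: norm_eq_sqrt_inner)
  qed
  have M_close: "norm (M p z - space_point z 0) \<le> (1 / 2) * cmod z" if p: "p \<in> C" for p z
  proof -
    let ?a = "cross2 z (nxt p - v) / area p" and ?b = "cross2 (p - v) z / area p"
    have nC: "nxt p \<in> C" by (rule nxt_props(1)[OF p])
    have "space_point z 0 = ?a *\<^sub>R space_point (p - v) 0 + ?b *\<^sub>R space_point (nxt p - v) 0"
      by (subst decompose[OF p, of z])
         (simp add: space_point_def vec_eq_iff forall_3)
    then have "M p z - space_point z 0
        = ?a *\<^sub>R (W p - space_point (p - v) 0) + ?b *\<^sub>R (W (nxt p) - space_point (nxt p - v) 0)"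
      by (simp add: M_def algebra_simps)
    also have "norm \<dots> \<le> \<bar>?a\<bar> * norm (W p - space_point (p - v) 0)
        + \<bar>?b\<bar> * norm (W (nxt p) - space_point (nxt p - v) 0)"
      by (metis norm_scaleR norm_triangle_ineq)
    also have "\<dots> \<le> (cmod z * r / \<mu>) * (\<mu> / (4 * r)) + (cmod z * r / \<mu>) * (\<mu> / (4 * r))"
    proof -
      have "\<bar>c\<bar> / area p \<le> cmod z * r / \<mu>" if "\<bar>c\<bar> \<le> cmod z * r" for c
        using that \<mu>(1) \<mu>(2)[OF p] r by (intro frac_le) auto
      then have "\<bar>?a\<bar> \<le> cmod z * r / \<mu>" "\<bar>?b\<bar> \<le> cmod z * r / \<mu>"
        using abs_cross2_le[of z "nxt p - v"] abs_cross2_le[of "p - v" z]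
          norm_crease[OF p] norm_crease[OF nC] area_pos[OF p]
        by (simp_all add: abs_divide mult.commute)
      then show ?thesis
        using W_close[OF p] W_close[OF nC] \<mu>(1) r by (intro add_mono mult_mono) auto
    qed
    also have "\<dots> = (1 / 2) * cmod z" using \<mu>(1) r by (simp add: field_simps)
    finally show ?thesis .
  qed
  \<comment> \<open>Assigns \<open>x\<close> to the half-open sector that contains it. At
    \<open>v\<close> the choice is irrelevant: every linear map gives 0 there.\<close>
  define last where "last x = (SOME p. p \<in> C \<and> ccw_angle v p x < ccw_angle v p (nxt p))" for x
  have last: "last x \<in> C" "ccw_angle v (last x) x < ccw_angle v (last x) (nxt (last x))" if "x \<noteq> v" for x
    using someI_ex[of "\<lambda>p. p \<in> C \<and> ccw_angle v p x < ccw_angle v p (nxt p)"]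
      exists_last_crease[OF order_refl C_ne nxt_props(1) that] unfolding last_def by blast+
  have last_eq: "last x = p" if "x \<noteq> v" "p \<in> C" "ccw_angle v p x < ccw_angle v p (nxt p)" for x p
    by (rule last_crease_unique[OF last(1)[OF that(1)] that(2,1) last(2)[OF that(1)] that(3)])
  define f where "f x = M (last x) (x - v)" for x
  have f_face: "f x = M p (x - v)" if p: "p \<in> C" and x: "x \<in> face p" for p x
  proof (cases "x = v \<or> ccw_angle v p x < ccw_angle v p (nxt p)")
    case True
    then show ?thesis using last_eq[of x p] p linear_0[OF bounded_linear.linear[OF M_linear]]
      by (cases "x = v") (auto simp: f_def)
  next
    case False
    then have xv: "x \<noteq> v" and eq: "ccw_angle v p x = ccw_angle v p (nxt p)"
      using x by (auto simp: sector_def)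
    have nC: "nxt p \<in> C" by (rule nxt_props(1)[OF p])
    \<comment> \<open>A point on the closing crease of a face is assigned to the next face. Both
      linear maps send that crease to \<open>W (nxt p)\<close>, so they agree.\<close>
    have on_ray: "ccw_angle v (nxt p) x = 0"
      using ccw_angle_change[of p v "nxt p" x] crease_ne p nC xv eq by simp
    then have "last x = nxt p"
      using nxt_angle_pos[OF nC] by (intro last_eq xv nC) simp
    moreover obtain t where t: "x - v = t *\<^sub>R (nxt p - v)"
      using ccw_angle_eq_0D[OF crease_ne[OF nC] on_ray] by (auto simp: scaleR_conv_of_real)
    ultimately show ?thesis
      by (simp add: f_def t M_crease[OF nC] M_crease[OF p]
          linear_scale[OF bounded_linear.linear[OF M_linear]] del: diff_eq_eq)
  qed
  have M_diff: "M p (x - v) - M p (y - v) = M p (x - y)" for p x y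
    using linear_diff[OF bounded_linear.linear[OF M_linear], of p "x - v" "y - v"] by simp
  have iso: "dist (f x) (f y) = dist x y" if "p \<in> C" "x \<in> face p" "y \<in> face p" for p x y
    by (simp add: f_face[OF that(1)] that dist_norm M_diff M_norm[OF that(1)])
  have "1-lipschitz_on (cball v r) f"
    by (intro lipschitz_from_faces lipschitz_onI) (auto simp: iso)
  then have cont: "continuous_on (cball v r) f" by (rule lipschitz_on_continuous_on)
  have "(1 / 2)-lipschitz_on (cball v r) (\<lambda>x. f x - space_point (x - v) 0)"
  proof (intro lipschitz_from_faces lipschitz_onI)
    fix p x y assume *: "p \<in> C" "x \<in> face p" "y \<in> face p"
    have "f x - space_point (x - v) 0 - (f y - space_point (y - v) 0) = M p (x - y) - space_point (x - y) 0"
      using M_diff[of p x y] space_point_diff[of "x - v" "y - v" 0 0] by (simp add: f_face[OF *(1)] * algebra_simps)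
    then show "dist (f x - space_point (x - v) 0) (f y - space_point (y - v) 0) \<le> 1 / 2 * dist x y"
      using M_close[OF *(1), of "x - y"] by (simp add: dist_norm)
  qed auto
  then have near_flat: "norm ((f x - space_point (x - v) 0) - (f y - space_point (y - v) 0)) \<le> (1 / 2) * cmod (x - y)"
    if "x \<in> cball v r" "y \<in> cball v r" for x y
    using lipschitz_onD that by (fastforce simp: dist_norm)
  have inj: "inj_on f (cball v r)"
  proof (rule inj_onI)
    fix x y assume *: "x \<in> cball v r" "y \<in> cball v r" "f x = f y"
    \<comment> \<open>Equal images would force the distance of the flat points to be at most half of
      itself.\<close>
    have "(f x - space_point (x - v) 0) - (f y - space_point (y - v) 0) = space_point (y - x) 0"
      using *(3) space_point_diff[of "y - v" "x - v" 0 0] by simp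
    then have "cmod (y - x) \<le> (1 / 2) * cmod (x - y)"
      using near_flat[OF *(1,2)] by (simp add: norm_space_point)
    then show "x = y" by (simp add: norm_minus_commute)
  qed
  have crease_subset: "crease v p \<subseteq> cball v r" if "p \<in> C" for p
    using crease_in_cball[OF that] r by (simp add: crease_def closed_segment_subset)
  have smooth: "f differentiable (at x within cball v r)"
    if x: "x \<in> cball v r" and off: "x \<notin> (\<Union>p\<in>C. crease v p)" for x
  proof -
    have xv: "x \<noteq> v" using off C_ne by (auto simp: crease_def)
    define p where "p = last x"
    have p: "p \<in> C" "ccw_angle v p x < ccw_angle v p (nxt p)" using last[OF xv] by (simp_all add: p_def)
    have "ccw_angle v p x \<noteq> 0"
    proof
      assume "ccw_angle v p x = 0"
      then obtain t where t: "t \<ge> 0" "x - v = of_real t * (p - v)"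
        using ccw_angle_eq_0D[OF crease_ne[OF p(1)]] by blast
      have "cmod (x - v) \<le> r" using x by (simp add: dist_norm norm_minus_commute)
      then have "t * r \<le> r" using t norm_crease[OF p(1)] by (simp add: norm_mult)
      then have "t \<le> 1" using r by simp
      moreover have "x = (1 - t) *\<^sub>R v + t *\<^sub>R p" using t(2) by (simp add: scaleR_conv_of_real algebra_simps)
      ultimately have "x \<in> crease v p" using t(1) by (auto simp: crease_def in_segment)
      with off p(1) show False by blast
    qed
    then have ang: "0 < ccw_angle v p x" using ccw_angle_bounds(1)[of v p x] by simp
    \<comment> \<open>The strict lower bound avoids the ray through \<open>p\<close>, where
      \<open>Arg2pi\<close> jumps, so this part of the sector is open.\<close>
    let ?O = "(\<lambda>y. (y - v) / (p - v)) -` ({z. 0 < Arg2pi z} \<inter> {z. Arg2pi z < ccw_angle v p (nxt p)})"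
    have "open ?O"
      using ccw_angle_bounds(2)[of v p "nxt p"]
      by (intro open_vimage open_Arg2pi2pi_less_Int) (simp_all add: divide_inverse, intro continuous_intros)
    moreover have "x \<in> ?O" using ang p(2) by (simp add: ccw_angle_def)
    ultimately obtain d where d: "d > 0" "\<And>y. dist y x < d \<Longrightarrow> y \<in> ?O"
      unfolding open_dist by blast
    have "M p (y - v) = f y" if "y \<in> cball v r" "dist y x < d" for y
      using d(2)[OF that(2)] that(1) by (intro f_face[OF p(1), symmetric]) (auto simp: sector_def ccw_angle_def)
    moreover have "(\<lambda>y. M p (y - v)) differentiable (at x within cball v r)"
    proof (rule differentiableI)
      have "((\<lambda>y. y - v) has_derivative (\<lambda>y. y)) (at x within cball v r)"
        using has_derivative_diff[OF has_derivative_ident has_derivative_const] by simp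
      from bounded_linear.has_derivative[OF M_linear this]
      show "((\<lambda>y. M p (y - v)) has_derivative M p) (at x within cball v r)" .
    qed
    ultimately show ?thesis
      using differentiable_transform_within[OF _ d(1) x] by blast
  qed
  have fold: "\<not> f differentiable (at x within cball v r)" if on: "q \<in> C" "x \<in> crease v q" for x q
  proof
    assume "f differentiable (at x within cball v r)"
    then obtain D where D: "(f has_derivative D) (at x within cball v r)"
      by (auto simp: differentiable_def)
    have linD: "linear D" by (rule has_derivative_linear[OF D])
    obtain t where t: "0 \<le> t" "t \<le> 1" "x = v + t *\<^sub>R (q - v)"
      using on(2) by (auto simp: crease_def in_segment algebra_simps)
    \<comment> \<open>Both \<open>x\<close> and \<open>y\<close> lie in the convex cone of one face,
      so the segment between them stays in that face, where \<open>f\<close> is affine.\<close>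
    have along: "D (y - x) = M p (y - x)" if p: "p \<in> C" and y: "y \<in> cball v r"
      and ab: "a \<ge> 0" "b \<ge> 0" "y - v = a *\<^sub>R (p - v) + b *\<^sub>R (nxt p - v)"
      and cd: "c \<ge> 0" "d \<ge> 0" "x - v = c *\<^sub>R (p - v) + d *\<^sub>R (nxt p - v)" for p y a b c d
    proof (rule derivative_along_segment[OF D])
      have xc: "x \<in> cball v r"
        using crease_subset on by blast
      have in_f: "x + s *\<^sub>R (y - x) \<in> face p" if s: "0 \<le> s" "s \<le> 1" for s
      proof -
        have e: "x + s *\<^sub>R (y - x) - v
            = ((1 - s) * c + s * a) *\<^sub>R (p - v) + ((1 - s) * d + s * b) *\<^sub>R (nxt p - v)"
        proof -
          have "x + s *\<^sub>R (y - x) - v = (1 - s) *\<^sub>R (x - v) + s *\<^sub>R (y - v)"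
            by (simp add: algebra_simps)
          then show ?thesis unfolding ab(3) cd(3) by (simp add: algebra_simps)
        qed
        have "ccw_angle v p (x + s *\<^sub>R (y - x)) \<le> ccw_angle v p (nxt p)"
          using crease_ne[OF p] crease_ne[OF nxt_props(1)[OF p]] nxt_angle_pos[OF p] lt_pi[OF p] s ab(1,2) cd(1,2) e
          by (intro ccw_angle_cone[where a = "(1 - s) * c + s * a" and b = "(1 - s) * d + s * b"])
             (auto simp: scaleR_conv_of_real)
        moreover have "x + s *\<^sub>R (y - x) \<in> cball v r"
          using convexD_alt[OF convex_cball xc y s] by (simp add: algebra_simps)
        ultimately show ?thesis by (simp add: sector_def)
      qed
      fix s :: real assume s: "0 \<le> s" "s \<le> 1"
      have "f (x + s *\<^sub>R (y - x)) - f x = M p (s *\<^sub>R (y - x))"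
        using f_face[OF p in_f[OF s]] f_face[OF p in_f[of 0]] M_diff[of p "x + s *\<^sub>R (y - x)" x] by simp
      then have "f (x + s *\<^sub>R (y - x)) = f x + s *\<^sub>R M p (y - x)"
        unfolding linear_scale[OF bounded_linear.linear[OF M_linear]] by (simp only: diff_eq_eq add.commute)
      moreover have "x + s *\<^sub>R (y - x) \<in> cball v r" using in_f[OF s] by (simp add: sector_def)
      ultimately show "x + s *\<^sub>R (y - x) \<in> cball v r \<and> f (x + s *\<^sub>R (y - x)) = f x + s *\<^sub>R M p (y - x)"
        by blast
    qed
    \<comment> \<open>Taking \<open>y\<close> to be \<open>v\<close>, \<open>p\<close> and
      \<open>nxt p\<close> and subtracting moves the base point of the directions from
      \<open>x\<close> to the vertex.\<close>
    have agree: "D (p - v) = M p (p - v) \<and> D (nxt p - v) = M p (nxt p - v)"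
      if p: "p \<in> C" and cd: "c \<ge> 0" "d \<ge> 0" "x - v = c *\<^sub>R (p - v) + d *\<^sub>R (nxt p - v)" for p c d
    proof -
      have "D (v - x) = M p (v - x)"
        using along[OF p _ _ _ _ cd, of v 0 0] r by simp
      moreover have "D (p - x) = M p (p - x)"
        using along[OF p crease_in_cball[OF p] _ _ _ cd, of 1 0] by simp
      moreover have "D (nxt p - x) = M p (nxt p - x)"
        using along[OF p crease_in_cball[OF nxt_props(1)[OF p]] _ _ _ cd, of 0 1] by simp
      moreover have "L (y - v) = L (y - x) - L (v - x)" if "linear L" for L :: "complex \<Rightarrow> real^3" and y
        using linear_diff[OF that, of "y - x" "v - x"] by simp
      ultimately show ?thesis using linD bounded_linear.linear[OF M_linear] by metis
    qed
    \<comment> \<open>The crease \<open>q\<close> bounds the faces starting at its predecessor and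
      at \<open>q\<close> itself. The vertex is covered as well, with \<open>t = 0\<close>.\<close>
    obtain p where p: "p \<in> C" "nxt p = q" using nxt_surj[OF on(1)] by blast
    have "D (p - v) = W p" "D (q - v) = W q"
      using agree[OF p(1), of 0 t] t M_crease[OF p(1)] p(2) by simp_all
    moreover have "D (nxt q - v) = W (nxt q)"
      using agree[OF on(1), of t 0] t M_crease[OF on(1)] by simp
    ultimately show False using W_bent[OF p(1) linD] p(2) by simp
  qed
  have "{x \<in> cball v r. \<not> f differentiable (at x within cball v r)} = (\<Union>p\<in>C. crease v p)"
    using smooth fold crease_subset by blast
  then have "rigid_origami v r C f"
    unfolding rigid_origami_def faces_eq using cont inj iso by blast
  then show ?thesis unfolding rigidly_foldable_def by blast
qed

end

theorem theorem2:
  fixes v :: complex and r :: real and C :: "complex set"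
  assumes "r > 0" and "crease_pattern v r C"
  shows "rigidly_foldable v r C \<longleftrightarrow>
    card C \<ge> 4 \<and> (\<forall>\<theta>\<in>sector_angles v C. \<theta> < pi) \<and> \<not> unspecified_cross v C"
proof -
  interpret crease_fan v r C using assms by unfold_locales
  have angles: "(\<forall>\<theta>\<in>sector_angles v C. \<theta> < pi) \<longleftrightarrow> (\<forall>p\<in>C. ccw_angle v p (nxt p) < pi)"
    by (auto simp: sector_angles_def next_crease_iff)
  show ?thesis
  proof
    assume "rigidly_foldable v r C"
    then obtain f where "rigid_origami v r C f" by (auto simp: rigidly_foldable_def)
    then interpret rigid_folding v r C f by unfold_locales
    show "card C \<ge> 4 \<and> (\<forall>\<theta>\<in>sector_angles v C. \<theta> < pi) \<and> \<not> unspecified_cross v C"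
      using card_C card_ne_3 sector_angle_lt_pi not_unspecified_cross angles by auto
  next
    assume "card C \<ge> 4 \<and> (\<forall>\<theta>\<in>sector_angles v C. \<theta> < pi) \<and> \<not> unspecified_cross v C"
    then show "rigidly_foldable v r C"
      using rigidly_foldableI angles by blast
  qed
qed

end
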